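(* There exist a compact metric graph $G$ of cycle rank two with seven edges, with standard Kirchhoff conditions at its internal vertices and Dirichlet conditions at two exterior endpoints, a fixed metric $\ell\in(0,\infty)^7$, and a measurable observation set $\omega\subset G$ such that $$C_\infty(\omega;\ell)<C_{\mathrm{sing}}(\omega;\ell).$$ More precisely, for the crossed graph $G=G_\times$ described in the context, one may choose $\ell$ and $\omega$ so that the observation lengths $\alpha_e=|\omega\cap e|$ have the form $$\alpha=\tfrac12\ell+\varepsilon\widehat d,\qquad \varepsilon>0,\qquad 0<\alpha_e<\ell_e\ \text{ for every edge } e,$$ where, in the edge order $(e_{13},e_{14},e_{\mathrm{ext},2},e_{\mathrm{ext},4},e_{12},e_{23},e_{34})$, $$\widehat d=\left(\tfrac{117}{25},\tfrac{106}{25},\tfrac35,\tfrac{109}{50},\tfrac{33}{20},-\tfrac{149}{100},-\tfrac{13}{100}\right),$$ and $$C_\infty(\omega;\ell)<\tfrac12<C_{\mathrm{sing}}(\omega;\ell).$$ Moreover, the upper bound on $C_\infty$ is realized asymptotically by an exact eigensequence: there are frequencies $k_n\to\infty$ and eigenfunctions $u_n$ with $-\Delta_{G,\ell}u_n=k_n^2u_n$, $\|u_n\|_{L^2(G)}=1$, whose homogenized intensities $q(u_n)$ converge to $r^\star/(\ell\cdot r^\star)$, where $r^\star$ is the edge-energy vector of a regular scalar secular state of $G_\times$ at a nonsingular phase point with one-dimensional secular kernel and $\widehat d\cdot r^\star<0$ (so $\lim_n\int_\omega|u_n|^2=\alpha\cdot r^\star/(\ell\cdot r^\star)<\tfrac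12$).
   Context: **Graph.** $G_\times$ has internal vertices $v_1,v_2,v_3,v_4$ and two exterior (degree-one) Dirichlet vertices $b_2,b_4$. Its seven edges are $e_{12}=v_1v_2$, $e_{23}=v_2v_3$, $e_{34}=v_3v_4$, $e_{13}=v_1v_3$, $e_{14}=v_1v_4$, $e_{\mathrm{ext},2}=v_2b_2$, $e_{\mathrm{ext},4}=v_4b_4$. A metric is a vector $\ell=(\ell_e)\in(0,\infty)^7$ of edge lengths. $-\Delta_{G,\ell}$ acts as $-d^2/dx^2$ on edges, with the standard Kirchhoff condition (continuity and vanishing sum of outward derivatives) at each $v_i$ and Dirichlet conditions at $b_2,b_4$. **Localization constant.** For measurable $\omega\subset G$, $$C_\infty(\omega;\ell):=\lim_{\Lambda\to\infty}\ \inf\Big\{\int_\omega|u|^2:\ -\Delta_{G,\ell}u=\lambda u,\ \lambda\ge\Lambda,\ \|u\|_{L^2(G)}=1\Big\}.$$ **Intensity.** If $-\Delta_{G,\ell}u=k^2u$, $k>0$, and $u_e(x)=A_e\cos(kx)+B_e\sin(kx)$ on $e\cong[0,\ell_e]$, the homogenized intensity is $q(u)=(q_e(u))_e$ with $q_e(u)=(|A_e|^2+|B_e|^2)/2$. **Singular-completion constant.** Orient each edge (terminal edges from the internal to the exterior endpoint). A boundary-compatible singular sector $\sigma$ assigns to each internal--internal edge $e$ a parity $\sigma_e\in\{\pm1\}$ ($\sigma_e=\cos\theta_e$, $\theta_e\in\pi\mathbb Z$), and to each Dirichlet terminal edge a phase class in $\pi\mathbb Z$. Let $B_{\sigma,\mathrm{bc}}$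 be the real matrix with rows indexed by $v_1,\dots,v_4$ and columns by the edges: the column of an internal--internal edge oriented from $v_-$ to $v_+$ has entry $1$ in row $v_-$, $-\sigma_e$ in row $v_+$, and zeros elsewhere; the column of a terminal edge has entry $1$ at its internal endpoint and zeros elsewhere. Put $A^{\circ2}=(A_e^2)_e$ and let $\mathcal M_G^{\mathrm{bc}}$ be the convex cone generated by all $A^{\circ 2}$ with $A\in\ker B_{\sigma,\mathrm{bc}}$, over all sectors $\sigma$. With $\alpha_e=|\omega\cap e|$, $$C_{\mathrm{sing}}(\omega;\ell):=\min\{\alpha\cdot s:\ s\in\mathcal M_G^{\mathrm{bc}},\ \ell\cdot s=1\}.$$ **Regular scalar secular states of $G_\times$.** Such a state at a phase vector $\theta\in(\mathbb R/2\pi\mathbb Z)^7$ consists of real vertex values $\phi_v$ ($v\in\{v_1,\dots,v_4\}$) and real normalized outward derivatives $p_{v,e}$ for each incidence of an edge $e$ with an internal vertex $v$, not all zero, with: $\sum_{e\sim v}p_{v,e}=0$ at each internal vertex; for each internal--internal edge $e=vw$, $\theta_e\notin\pi\mathbb Z$, $\phi_w=\phi_v\cos\theta_e+p_{v,e}\sin\theta_e$ and $-p_{w,e}=-\phi_v\sin\theta_e+p_{v,e}\cos\theta_e$; for each Dirichlet terminal edge at $v$, $\phi_v\cos\theta_e+p_{v,e}\sin\theta_e=0$. Its edge-energy vector is $r_e=\phi_v^2+p_{v,e}^2$ (independent of the internal endpoint $v$ of $e$ used). The phase point is nonsingular if no $\theta_e$ lies in $\pi\mathbb Z$; the secular kernel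 is the linear space of all $(\phi,p)$ satisfying these equations at $\theta$. *)

theory Defs
  imports "HOL-Analysis.Analysis"
begin

section \<open>Metric graphs with Kirchhoff and Dirichlet vertices\<close>

text \<open>
  The types \<open>'v\<close>, \<open>'b\<close>, \<open>'e\<close> are the (finite) sets of internal vertices, exterior Dirichlet
  vertices and edges.  Every edge is oriented; a terminal edge runs from its internal endpoint to
  its exterior endpoint, so only the head of an edge can be exterior.  Loops and multiple edges are
  permitted.
\<close>

record ('v, 'b, 'e) mgraph =
  tail :: "'e \<Rightarrow> 'v"
  head :: "'e \<Rightarrow> 'v + 'b"

definition internal_edge :: "('v, 'b, 'e) mgraph \<Rightarrow> 'e \<Rightarrow> bool" where
  "internal_edge G e \<longleftrightarrow> (\<exists>w. head G e = Inl w)"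

definition adjacency :: "('v, 'b, 'e) mgraph \<Rightarrow> (('v + 'b) \<times> ('v + 'b)) set" where
  "adjacency G = {(x, y). \<exists>e. {x, y} = {Inl (tail G e), head G e}}"

definition connected_graph :: "('v, 'b, 'e) mgraph \<Rightarrow> bool" where
  "connected_graph G \<longleftrightarrow> (\<forall>x y. (x, y) \<in> (adjacency G)\<^sup>*)"

definition admissible_graph :: "('v::finite, 'b::finite, 'e::finite) mgraph \<Rightarrow> bool" where
  "admissible_graph G \<longleftrightarrow> connected_graph G \<and> (\<forall>b. \<exists>!e. head G e = Inr b)"

definition cycle_rank :: "('v::finite, 'b::finite, 'e::finite) mgraph \<Rightarrow> int" where
  "cycle_rank G =
     int CARD('e) - int CARD('v + 'b) + int (card (UNIV // (adjacency G)\<^sup>*))"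

definition edge_metric :: "real^'e \<Rightarrow> bool" where
  "edge_metric l \<longleftrightarrow> (\<forall>e. 0 < l $ e)"

text \<open>
  Points of the metric graph: its vertices and the points of its open edges.  The edge \<open>e\<close> is
  parametrised over \<open>{0..l $ e}\<close> from tail to head by \<open>edge_pt G l e\<close>, so a function on the graph is
  single valued at the vertices by construction.  Its values at points outside \<open>points l\<close> are
  irrelevant.
\<close>

datatype ('v, 'b, 'e) gpoint = Vertex "'v + 'b" | Inner 'e real

definition points :: "real^'e \<Rightarrow> ('v, 'b, 'e) gpoint set" where
  "points l = range Vertex \<union> {Inner e x | e x. 0 < x \<and> x < l $ e}"

definition edge_pt ::
  "('v, 'b, 'e) mgraph \<Rightarrow> real^'e \<Rightarrow> 'e \<Rightarrow> real \<Rightarrow> ('v, 'b, 'e) gpoint" where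
  "edge_pt G l e x =
     (if x \<le> 0 then Vertex (Inl (tail G e))
      else if l $ e \<le> x then Vertex (head G e)
      else Inner e x)"

definition edge_trace ::
  "('v, 'b, 'e) mgraph \<Rightarrow> real^'e \<Rightarrow> ('v, 'b, 'e) gpoint set \<Rightarrow> 'e \<Rightarrow> real set" where
  "edge_trace G l \<omega> e = {x \<in> {0..l $ e}. edge_pt G l e x \<in> \<omega>}"

definition measurable_subset ::
  "('v, 'b, 'e) mgraph \<Rightarrow> real^'e \<Rightarrow> ('v, 'b, 'e) gpoint set \<Rightarrow> bool" where
  "measurable_subset G l \<omega> \<longleftrightarrow>
     \<omega> \<subseteq> points l \<and> (\<forall>e. edge_trace G l \<omega> e \<in> sets lebesgue)"

definition obs_lengths ::
  "('v, 'b, 'e) mgraph \<Rightarrow> real^'e \<Rightarrow> ('v, 'b, 'e) gpoint set \<Rightarrow> real^'e" where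
  "obs_lengths G l \<omega> = (\<chi> e. measure lebesgue (edge_trace G l \<omega> e))"

definition integral_over ::
  "('v, 'b, 'e::finite) mgraph \<Rightarrow> real^'e \<Rightarrow> ('v, 'b, 'e) gpoint set \<Rightarrow>
    (('v, 'b, 'e) gpoint \<Rightarrow> real) \<Rightarrow> real" where
  "integral_over G l \<omega> f =
     (\<Sum>e\<in>UNIV. LINT x:edge_trace G l \<omega> e|lebesgue. f (edge_pt G l e x))"

definition L2_mass_on ::
  "('v, 'b, 'e::finite) mgraph \<Rightarrow> real^'e \<Rightarrow> ('v, 'b, 'e) gpoint set \<Rightarrow>
    (('v, 'b, 'e) gpoint \<Rightarrow> complex) \<Rightarrow> real" where
  "L2_mass_on G l \<omega> u = integral_over G l \<omega> (\<lambda>p. (cmod (u p))\<^sup>2)"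

definition L2_norm ::
  "('v, 'b, 'e::finite) mgraph \<Rightarrow> real^'e \<Rightarrow> (('v, 'b, 'e) gpoint \<Rightarrow> complex) \<Rightarrow> real" where
  "L2_norm G l u = sqrt (L2_mass_on G l (points l) u)"


section \<open>Eigenfunctions, localization constant and intensity\<close>

text \<open>
  \<open>laplace_eq G l \<mu> u\<close> says that \<open>u\<close> is in the domain of the Kirchhoff--Dirichlet Laplacian and
  that minus the Laplacian of \<open>u\<close> is \<open>\<mu> u\<close>.  Here \<open>du e\<close> is the derivative of \<open>u\<close> along the
  orientation of \<open>e\<close>, so the outward derivatives are \<open>du e 0\<close> at the tail and \<open>- du e (l $ e)\<close> at the
  head.  Continuity at the vertices is expressed by differentiability of the edge restrictions up to
  and including the endpoints, where they take the common vertex value.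
\<close>

definition laplace_eq ::
  "('v, 'b, 'e::finite) mgraph \<Rightarrow> real^'e \<Rightarrow> real \<Rightarrow> (('v, 'b, 'e) gpoint \<Rightarrow> complex) \<Rightarrow> bool"
  where
  "laplace_eq G l \<mu> u \<longleftrightarrow>
     (\<exists>du :: 'e \<Rightarrow> real \<Rightarrow> complex.
        (\<forall>e. \<forall>x\<in>{0..l $ e}.
           ((\<lambda>y. u (edge_pt G l e y)) has_vector_derivative du e x) (at x within {0..l $ e}) \<and>
           (du e has_vector_derivative - (\<mu> *\<^sub>R u (edge_pt G l e x))) (at x within {0..l $ e})) \<and>
        (\<forall>v. (\<Sum>e | tail G e = v. du e 0) + (\<Sum>e | head G e = Inl v. - du e (l $ e)) = 0) \<and>
        (\<forall>b. u (Vertex (Inr b)) = 0))"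

definition C_infinity ::
  "('v, 'b, 'e::finite) mgraph \<Rightarrow> real^'e \<Rightarrow> ('v, 'b, 'e) gpoint set \<Rightarrow> real" where
  "C_infinity G l \<omega> =
     Lim at_top (\<lambda>\<Lambda>::real.
       Inf {L2_mass_on G l \<omega> u | u \<mu>. laplace_eq G l \<mu> u \<and> \<Lambda> \<le> \<mu> \<and> L2_norm G l u = 1})"

text \<open>The intensity is meaningful for an eigenfunction at frequency \<open>k > 0\<close>; there the pair
  \<open>A\<close>, \<open>B\<close> exists and is unique on every edge.\<close>

definition intensity ::
  "('v, 'b, 'e) mgraph \<Rightarrow> real^'e \<Rightarrow> real \<Rightarrow> (('v, 'b, 'e) gpoint \<Rightarrow> complex) \<Rightarrow> real^'e" where
  "intensity G l k u = (\<chi> e. THE q. \<exists>A B :: complex.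
     (\<forall>x\<in>{0..l $ e}. u (edge_pt G l e x) =
        A * complex_of_real (cos (k * x)) + B * complex_of_real (sin (k * x))) \<and>
     q = ((cmod A)\<^sup>2 + (cmod B)\<^sup>2) / 2)"


section \<open>Singular-completion constant\<close>

definition pi_multiples :: "real set" where
  "pi_multiples = range (\<lambda>n::int. of_int n * pi)"

text \<open>A boundary-compatible singular sector is given by phases in \<open>\<pi>\<int>\<close> on all edges; the parity of
  an internal edge is the cosine of its phase.\<close>

definition singular_sector :: "real^'e \<Rightarrow> bool" where
  "singular_sector \<theta> \<longleftrightarrow> (\<forall>e. \<theta> $ e \<in> pi_multiples)"

definition B_bc :: "('v, 'b, 'e) mgraph \<Rightarrow> real^'e \<Rightarrow> real^'e^'v" where
  "B_bc G \<theta> = (\<chi> v e.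
     (if tail G e = v then 1 else 0) - (if head G e = Inl v then cos (\<theta> $ e) else 0))"

definition M_bc :: "('v::finite, 'b, 'e::finite) mgraph \<Rightarrow> (real^'e) set" where
  "M_bc G = convex_cone hull
     {(\<chi> e. (A $ e)\<^sup>2) | A \<theta>. singular_sector \<theta> \<and> B_bc G \<theta> *v A = 0}"

definition C_sing ::
  "('v::finite, 'b, 'e::finite) mgraph \<Rightarrow> real^'e \<Rightarrow> ('v, 'b, 'e) gpoint set \<Rightarrow> real" where
  "C_sing G l \<omega> =
     (LEAST c. \<exists>s\<in>M_bc G. l \<bullet> s = 1 \<and> c = obs_lengths G l \<omega> \<bullet> s)"


section \<open>Scalar secular states\<close>

text \<open>
  A triple \<open>(\<phi>, p, p')\<close> holds the vertex values and the normalized outward derivatives: \<open>p $ e\<close> at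
  the tail of \<open>e\<close>, \<open>p' $ e\<close> at the head of \<open>e\<close>.  The latter is no datum for a terminal edge and is
  then set to \<open>0\<close>.  Phases modulo \<open>2\<pi>\<close> are given by real representatives.
\<close>

definition secular_kernel ::
  "('v::finite, 'b, 'e::finite) mgraph \<Rightarrow> real^'e \<Rightarrow> ((real^'v) \<times> (real^'e) \<times> (real^'e)) set" where
  "secular_kernel G \<theta> = {(\<phi>, p, p').
     (\<forall>v. (\<Sum>e | tail G e = v. p $ e) + (\<Sum>e | head G e = Inl v. p' $ e) = 0) \<and>
     (\<forall>e w. head G e = Inl w \<longrightarrow>
        \<phi> $ w = \<phi> $ tail G e * cos (\<theta> $ e) + p $ e * sin (\<theta> $ e) \<and>
        - (p' $ e) = - (\<phi> $ tail G e) * sin (\<theta> $ e) + p $ e * cos (\<theta> $ e)) \<and>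
     (\<forall>e b. head G e = Inr b \<longrightarrow>
        \<phi> $ tail G e * cos (\<theta> $ e) + p $ e * sin (\<theta> $ e) = 0 \<and> p' $ e = 0)}"

definition regular_state ::
  "('v::finite, 'b, 'e::finite) mgraph \<Rightarrow> real^'e \<Rightarrow> (real^'v) \<times> (real^'e) \<times> (real^'e) \<Rightarrow> bool" where
  "regular_state G \<theta> s \<longleftrightarrow>
     s \<in> secular_kernel G \<theta> \<and> s \<noteq> 0 \<and> (\<forall>e. internal_edge G e \<longrightarrow> \<theta> $ e \<notin> pi_multiples)"

definition nonsingular_phase :: "real^'e \<Rightarrow> bool" where
  "nonsingular_phase \<theta> \<longleftrightarrow> (\<forall>e. \<theta> $ e \<notin> pi_multiples)"

text \<open>Evaluated at the tail; for a secular state the head of an internal edge gives the same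
  value.\<close>

definition edge_energy ::
  "('v, 'b, 'e) mgraph \<Rightarrow> (real^'v) \<times> (real^'e) \<times> (real^'e) \<Rightarrow> real^'e" where
  "edge_energy G = (\<lambda>(\<phi>, p, p'). \<chi> e. (\<phi> $ tail G e)\<^sup>2 + (p $ e)\<^sup>2)"


section \<open>The crossed graph\<close>

datatype vtx = v1 | v2 | v3 | v4
datatype ext = b2 | b4
datatype edge = e13 | e14 | eext2 | eext4 | e12 | e23 | e34

lemma UNIV_vtx: "UNIV = {v1, v2, v3, v4}"
  using vtx.exhaust by auto

lemma UNIV_ext: "UNIV = {b2, b4}"
  using ext.exhaust by auto

lemma UNIV_edge: "UNIV = {e13, e14, eext2, eext4, e12, e23, e34}"
  using edge.exhaust by auto

instance vtx :: finite
  by standard (simp add: UNIV_vtx)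

instance ext :: finite
  by standard (simp add: UNIV_ext)

instance edge :: finite
  by standard (simp add: UNIV_edge)

definition G_cross :: "(vtx, ext, edge) mgraph" where
  "G_cross = \<lparr>
     tail = (\<lambda>e. case e of e13 \<Rightarrow> v1 | e14 \<Rightarrow> v1 | eext2 \<Rightarrow> v2 | eext4 \<Rightarrow> v4
                         | e12 \<Rightarrow> v1 | e23 \<Rightarrow> v2 | e34 \<Rightarrow> v3),
     head = (\<lambda>e. case e of e13 \<Rightarrow> Inl v3 | e14 \<Rightarrow> Inl v4 | eext2 \<Rightarrow> Inr b2 | eext4 \<Rightarrow> Inr b4
                         | e12 \<Rightarrow> Inl v2 | e23 \<Rightarrow> Inl v3 | e34 \<Rightarrow> Inl v4)\<rparr>"

definition d_hat :: "real^edge" where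
  "d_hat = (\<chi> e. case e of
       e13 \<Rightarrow> 117/25 | e14 \<Rightarrow> 106/25 | eext2 \<Rightarrow> 3/5 | eext4 \<Rightarrow> 109/50
     | e12 \<Rightarrow> 33/20 | e23 \<Rightarrow> - 149/100 | e34 \<Rightarrow> - 13/100)"

end

theory Submission
  imports Defs "HOL-Analysis.Kronecker_Approximation_Theorem"
begin

text \<open>
  Write an eigenfunction at frequency \<open>k\<close> edge by edge as \<open>\<phi> cos(kx) + p sin(kx)\<close>, with \<open>\<phi>\<close> the
  vertex value and \<open>p\<close> the normalized derivative at the tail.  For large \<open>k\<close> its square has mean
  \<open>r\<^sub>e / 2\<close> on every piece of the edge \<open>e\<close>, where \<open>r\<^sub>e = \<phi>\<^sup>2 + p\<^sup>2\<close>.  The normalized mass on an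
  observation set with lengths \<open>\<alpha>\<close> is thus close to \<open>\<alpha>\<bullet>r / l\<bullet>r\<close>.  For \<open>\<alpha> = l/2 + \<epsilon> d\<close>, with \<open>d\<close>
  the vector \<open>d_hat\<close>, this number is \<open>1/2 + \<epsilon> d\<bullet>r / l\<bullet>r\<close>: only the sign of \<open>d\<bullet>r\<close> matters.

  On singular profiles \<open>d\<close> is positive.  The vertex equations leave three free amplitudes, and
  absorbing the parities into signs turns \<open>d\<bullet>A\<^sup>2\<close> into one of four ternary quadratic forms, each
  of which is positive definite by Sylvester's criterion (\<open>d_hat_positive_on_singular\<close>).  The normalized
  generators form a compact set, so the minimum that defines \<open>C_sing\<close> is attained on a generator and
  exceeds \<open>1/2\<close> strictly (\<open>C_sing_gt\<close>).

  On some regular states \<open>d\<close> is negative.  An explicit one has vertex values \<open>1, 1/5, 0, 1/5\<close>; the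
  phases of its internal edges have rational sines, and \<open>d\<bullet>r\<close> is about \<open>-0.28\<close> (\<open>base_phase\<close>, \<open>base_energy_d_hat\<close>).
  It remains to realize it asymptotically by eigenfunctions of one fixed metric.  Take for the
  lengths \<open>l\<close> the phases of this state; then it is an exact state at \<open>k = 1\<close>.  By Dirichlet's
  simultaneous approximation theorem the curve \<open>k \<mapsto> k l\<close> on the torus returns arbitrarily close to
  \<open>l\<close> at arbitrarily late times.  The secular function vanishes at \<open>l\<close> and has there the
  derivative \<open>l\<bullet>r > 0\<close> in the direction \<open>l\<close>, so by the intermediate value theorem every close
  return passes through an exact zero (\<open>recurrent_zeros\<close>).  The state solving the vertex equations
  depends continuously on the phases, so the eigenfunctions at these zeros have intensities that
  converge to \<open>r / l\<bullet>r\<close> (\<open>eigensequence\<close>), and \<open>C_infinity\<close> is at most their limiting mass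
  (\<open>C_infinity_le_limit\<close>).
\<close>

section \<open>Recurrence of a linear flow on the torus\<close>

definition phases_match :: "real \<Rightarrow> real^'e \<Rightarrow> real^'e \<Rightarrow> bool" where
  "phases_match k l \<theta> \<longleftrightarrow> (\<forall>e. \<exists>m::int. k * l $ e = \<theta> $ e + 2 * pi * of_int m)"

lemma phases_match_trig:
  assumes "phases_match k l \<theta>"
  shows "cos (k * l $ e) = cos (\<theta> $ e)" "sin (k * l $ e) = sin (\<theta> $ e)"
proof -
  obtain m :: int where "k * l $ e = \<theta> $ e + 2 * pi * of_int m"
    using assms unfolding phases_match_def by blast
  thus "cos (k * l $ e) = cos (\<theta> $ e)" "sin (k * l $ e) = sin (\<theta> $ e)"
    by (simp_all add: cos_add sin_add)
qed

text \<open>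
  Dirichlet's theorem bounds the return time from above only, and it could return the same small time
  for every precision when \<open>l\<close> is commensurable with \<open>2\<pi>\<close>.  Applying it to a large multiple of \<open>l\<close>
  makes the return time a multiple of that factor, hence late.
\<close>

lemma torus_flow_returns:
  fixes l :: "real^'e::finite" and K \<eta> :: real
  assumes "\<eta> > 0"
  obtains T :: real and m :: "'e \<Rightarrow> int"
  where "K \<le> T" "\<And>e. \<bar>T * l $ e - 2 * pi * of_int (m e)\<bar> < \<eta>"
proof -
  define n where "n = CARD('e)"
  obtain f :: "nat \<Rightarrow> 'e" where f: "bij_betw f {0..<n} UNIV"
    using ex_bij_betw_nat_finite[of "UNIV :: 'e set"] n_def by auto
  obtain N :: nat where N: "2 * pi / \<eta> < N" using reals_Archimedean2 by blast
  have "0 < real N" using N assms by (smt (verit) divide_pos_pos pi_gt_zero)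
  hence N0: "0 < N" by simp
  define M where "M = nat \<lceil>max K 1\<rceil>"
  have M: "K \<le> real M" "1 \<le> real M" unfolding M_def by linarith+
  obtain q p where q: "0 < q"
    and qp: "\<And>i. i < n \<Longrightarrow> \<bar>of_int q * (real M * l $ f i / (2 * pi)) - of_int (p i)\<bar> < 1 / N"
    using Dirichlet_approx_simult[OF N0, of n "\<lambda>i. real M * l $ f i / (2 * pi)"] by metis
  show ?thesis
  proof (rule that)
    have q1: "1 \<le> real_of_int q" using q by linarith
    have "1 * real M \<le> real_of_int q * real M" using q1 by (intro mult_right_mono) auto
    thus "K \<le> real_of_int q * real M" using M by linarith
    fix e
    define i where "i = inv_into {0..<n} f e"
    have i: "i < n" "f i = e"
      using f unfolding i_def
      by (metis UNIV_I atLeastLessThan_iff bij_betw_def inv_into_into)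
         (metis UNIV_I bij_betw_inv_into_right f)
    have "real_of_int q * real M * l $ e - 2 * pi * real_of_int (p i)
        = 2 * pi * (of_int q * (real M * l $ e / (2 * pi)) - of_int (p i))"
      by (simp add: field_simps)
    hence "\<bar>real_of_int q * real M * l $ e - 2 * pi * real_of_int (p i)\<bar>
        = 2 * pi * \<bar>of_int q * (real M * l $ e / (2 * pi)) - of_int (p i)\<bar>"
      by (simp only: abs_mult) simp
    also have "\<dots> < 2 * pi * (1 / N)"
      using qp[OF i(1)] i(2) by (intro mult_strict_left_mono) auto
    also have "\<dots> < \<eta>" using N N0 assms by (simp add: field_simps)
    finally show "\<bar>real_of_int q * real M * l $ e
        - 2 * pi * real_of_int (p (inv_into {0..<n} f e))\<bar> < \<eta>"
      by (simp add: i_def)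
  qed
qed

text \<open>
  A transversal zero of \<open>F\<close> is stable: short segments in the direction \<open>l\<close> through points near \<open>l\<close>
  still join a negative to a positive value of \<open>F\<close>.  A late return of the flow \<open>k \<mapsto> k l\<close> provides such
  a segment inside the flow line, and the intermediate value theorem a zero on it.
\<close>

lemma crossing_recurs:
  fixes F :: "real^'e::finite \<Rightarrow> real" and l :: "real^'e" and D K \<delta> :: real
  assumes cont: "eventually (isCont F) (nhds l)"
    and zero: "F l = 0"
    and der: "((\<lambda>t. F (l + t *\<^sub>R l)) has_real_derivative D) (at 0)" "0 < D"
    and \<delta>: "0 < \<delta>"
  obtains k \<theta> where "K \<le> k" "dist \<theta> l < \<delta>" "F \<theta> = 0"
    "phases_match k l \<theta>"
proof -
  obtain \<rho> where \<rho>: "0 < \<rho>" "\<And>x. dist x l < \<rho> \<Longrightarrow> isCont F x"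
    using cont unfolding eventually_nhds_metric by blast
  obtain d1 where d1: "0 < d1" "\<And>h. 0 < h \<Longrightarrow> h < d1 \<Longrightarrow> 0 < F (l + h *\<^sub>R l)"
    using DERIV_pos_inc_right[OF der] zero by auto
  obtain d2 where d2: "0 < d2" "\<And>h. 0 < h \<Longrightarrow> h < d2 \<Longrightarrow> F (l - h *\<^sub>R l) < 0"
    using DERIV_pos_inc_left[OF der] zero by auto
  define r where "r = min \<delta> \<rho>"
  have r: "0 < r" using \<delta> \<rho> by (simp add: r_def)
  \<comment> \<open>Small enough for the signs at the two ends of the segment and for the whole segment
    to stay within half of the allowed distance; the other half is left for the return error.\<close>
  define h where "h = min (min d1 d2) (r / (norm l + 1)) / 2"
  have nl: "0 < norm l + 1" by (simp add: add_nonneg_pos)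
  have h0: "0 < h" using d1 d2 r nl by (simp add: h_def)
  have "h \<le> min d1 d2 / 2" unfolding h_def by (intro divide_right_mono) auto
  hence hd: "h < d1" "h < d2" using d1(1) d2(1) by auto
  have "h \<le> (r / (norm l + 1)) / 2" unfolding h_def by (intro divide_right_mono) auto
  hence "h * (norm l + 1) \<le> r / 2" using nl by (simp add: field_simps)
  hence hl: "h * norm l < r / 2" using h0 by (simp add: algebra_simps)
  have pos: "0 < F (l + h *\<^sub>R l)" and neg: "F (l - h *\<^sub>R l) < 0" using d1 d2 hd h0 by auto
  have dl: "dist (l + t *\<^sub>R l) l < r / 2" if "\<bar>t\<bar> \<le> h" for t
  proof -
    have "dist (l + t *\<^sub>R l) l = \<bar>t\<bar> * norm l" by (simp add: dist_norm)
    also have "\<dots> \<le> h * norm l" using that by (intro mult_right_mono) auto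
    finally show ?thesis using hl by simp
  qed
  have c1: "isCont F (l + h *\<^sub>R l)" "isCont F (l + (- h) *\<^sub>R l)"
  proof -
    have "r / 2 \<le> \<rho>" using r unfolding r_def by linarith
    thus "isCont F (l + h *\<^sub>R l)" "isCont F (l + (- h) *\<^sub>R l)"
      using dl[of h] dl[of "- h"] h0 by (intro \<rho>(2); linarith)+
  qed
  obtain e1 where e1: "0 < e1" "\<And>x. dist x (l + h *\<^sub>R l) < e1 \<Longrightarrow> 0 < F x"
    using order_tendstoD(1)[OF c1(1)[unfolded isCont_def tendsto_at_iff_tendsto_nhds] pos]
    unfolding eventually_nhds_metric by blast
  have neg': "F (l + (- h) *\<^sub>R l) < 0" using neg by simp
  obtain e2 where e2: "0 < e2" "\<And>x. dist x (l + (- h) *\<^sub>R l) < e2 \<Longrightarrow> F x < 0"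
    using order_tendstoD(2)[OF c1(2)[unfolded isCont_def tendsto_at_iff_tendsto_nhds] neg']
    unfolding eventually_nhds_metric by blast
  define \<eta> where "\<eta> = min (min e1 e2) (r / 2) / CARD('e)"
  have \<eta>: "0 < \<eta>" using e1 e2 r by (simp add: \<eta>_def)
  obtain T m where T: "K + h \<le> T" "\<And>e. \<bar>T * l $ e - 2 * pi * of_int (m e)\<bar> < \<eta>"
    using torus_flow_returns[OF \<eta>] by metis
  define \<xi> :: "real^'e" where "\<xi> = (\<chi> e. T * l $ e - 2 * pi * of_int (m e))"
  have "norm \<xi> \<le> (\<Sum>e\<in>UNIV. \<bar>\<xi> $ e\<bar>)" by (rule norm_le_l1_cart)
  also have "\<dots> < (\<Sum>e\<in>(UNIV::'e set). \<eta>)"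
    by (intro sum_strict_mono) (auto simp: \<xi>_def T)
  also have "\<dots> = min (min e1 e2) (r / 2)" by (simp add: \<eta>_def)
  finally have \<xi>: "norm \<xi> < e1" "norm \<xi> < e2" "norm \<xi> < r / 2" by auto
  define g where "g t = F (l + \<xi> + t *\<^sub>R l)" for t
  have near: "dist (l + \<xi> + t *\<^sub>R l) l < r" if "\<bar>t\<bar> \<le> h" for t
  proof -
    have "dist (l + \<xi> + t *\<^sub>R l) l = norm (\<xi> + t *\<^sub>R l)" by (simp add: dist_norm algebra_simps)
    also have "\<dots> \<le> norm \<xi> + norm (t *\<^sub>R l)" by (rule norm_triangle_ineq)
    also have "norm (t *\<^sub>R l) = dist (l + t *\<^sub>R l) l" by (simp add: dist_norm)
    finally show ?thesis using dl[OF that] \<xi> by linarith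
  qed
  have "\<exists>t\<ge>- h. t \<le> h \<and> g t = 0"
  proof (rule IVT)
    have "dist (l + \<xi> + (- h) *\<^sub>R l) (l + (- h) *\<^sub>R l) < e2"
      using \<xi> by (simp add: dist_norm algebra_simps)
    thus "g (- h) \<le> 0" using e2 unfolding g_def by (meson less_imp_le)
    have "dist (l + \<xi> + h *\<^sub>R l) (l + h *\<^sub>R l) < e1"
      using \<xi> by (simp add: dist_norm algebra_simps)
    thus "0 \<le> g h" using e1 unfolding g_def by (meson less_imp_le)
    show "- h \<le> h" using h0 by simp
    show "\<forall>t. - h \<le> t \<and> t \<le> h \<longrightarrow> isCont g t"
    proof (intro allI impI)
      fix t assume "- h \<le> t \<and> t \<le> h"
      hence "isCont F (l + \<xi> + t *\<^sub>R l)"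
        using near[of t] by (intro \<rho>) (auto simp: r_def)
      moreover have "isCont (\<lambda>t. l + \<xi> + t *\<^sub>R l) t" by (intro continuous_intros)
      ultimately show "isCont g t" unfolding g_def by (rule isCont_o2[rotated])
    qed
  qed
  then obtain t where t: "- h \<le> t" "t \<le> h" "g t = 0" by blast
  show ?thesis
  proof (rule that[of "1 + T + t" "l + \<xi> + t *\<^sub>R l"])
    show "K \<le> 1 + T + t" using T t by linarith
    show "dist (l + \<xi> + t *\<^sub>R l) l < \<delta>" using near[of t] t by (auto simp: r_def)
    show "F (l + \<xi> + t *\<^sub>R l) = 0" using t by (simp add: g_def)
    have "(1 + T + t) * l $ e = (l + \<xi> + t *\<^sub>R l) $ e + 2 * pi * of_int (m e)" for e
      by (simp add: \<xi>_def algebra_simps)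
    thus "phases_match (1 + T + t) l (l + \<xi> + t *\<^sub>R l)" unfolding phases_match_def by blast
  qed
qed

lemma recurrent_zeros:
  fixes F :: "real^'e::finite \<Rightarrow> real" and l :: "real^'e" and D :: real
  assumes "eventually (isCont F) (nhds l)" "F l = 0"
    and "((\<lambda>t. F (l + t *\<^sub>R l)) has_real_derivative D) (at 0)" "0 < D"
  obtains k :: "nat \<Rightarrow> real" and \<theta> :: "nat \<Rightarrow> real^'e"
  where "filterlim k at_top sequentially" "\<theta> \<longlonglongrightarrow> l" "\<And>n. F (\<theta> n) = 0"
    "\<And>n. phases_match (k n) l (\<theta> n)"
proof -
  define Q where "Q n k \<theta> \<longleftrightarrow> real n \<le> k \<and> dist \<theta> l < 1 / (real n + 1) \<and> F \<theta> = 0 \<and> phases_match k l \<theta>"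
    for n k \<theta>
  have "\<exists>k \<theta>. Q n k \<theta>" for n
  proof -
    have pos: "0 < 1 / (real n + 1)" by simp
    show ?thesis
    proof (rule crossing_recurs[where F = F and l = l and D = D and K = "real n", OF assms pos])
      fix k \<theta>
      assume "real n \<le> k" "dist \<theta> l < 1 / (real n + 1)" "F \<theta> = 0" "phases_match k l \<theta>"
      hence "Q n k \<theta>" unfolding Q_def by (intro conjI)
      thus "\<exists>k \<theta>. Q n k \<theta>" by (intro exI)
    qed
  qed
  then obtain k \<theta> where "\<And>n. Q n (k n) (\<theta> n)" by metis
  hence Q: "real n \<le> k n \<and> dist (\<theta> n) l < 1 / (real n + 1) \<and> F (\<theta> n) = 0 \<and> phases_match (k n) l (\<theta> n)"
    for n unfolding Q_def by this
  show ?thesis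
  proof (rule that[of k \<theta>])
    show "filterlim k at_top sequentially"
      using Q by (intro filterlim_at_top_mono[OF filterlim_real_sequentially] always_eventually) blast
    have "(\<lambda>n. dist (\<theta> n) l) \<longlonglongrightarrow> 0"
    proof (rule Lim_null_comparison)
      show "(\<lambda>n. 1 / (real n + 1)) \<longlonglongrightarrow> 0"
        using LIMSEQ_inverse_real_of_nat by (simp add: inverse_eq_divide add.commute)
      show "\<forall>\<^sub>F n in sequentially. norm (dist (\<theta> n) l) \<le> 1 / (real n + 1)"
        using Q by (intro always_eventually) (simp add: less_imp_le)
    qed
    thus "\<theta> \<longlonglongrightarrow> l" by (rule tendsto_dist_iff[THEN iffD2])
    show "F (\<theta> n) = 0" "phases_match (k n) l (\<theta> n)" for n using Q by blast+
  qed
qed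

section \<open>Eigenfunctions built from secular states\<close>

definition wave :: "('v, 'b, 'e) mgraph \<Rightarrow> real \<Rightarrow> (real^'v) \<times> (real^'e) \<times> (real^'e) \<Rightarrow> 'e \<Rightarrow> real \<Rightarrow> real"
  where "wave G k s e x = fst s $ tail G e * cos (k * x) + fst (snd s) $ e * sin (k * x)"

definition graph_wave :: "('v, 'b, 'e) mgraph \<Rightarrow> real \<Rightarrow> real \<Rightarrow> (real^'v) \<times> (real^'e) \<times> (real^'e)
    \<Rightarrow> ('v, 'b, 'e) gpoint \<Rightarrow> complex"
  where "graph_wave G k c s p = (case p of
      Vertex z \<Rightarrow> (case z of Inl v \<Rightarrow> of_real (c * fst s $ v) | Inr b \<Rightarrow> 0)
    | Inner e x \<Rightarrow> of_real (c * wave G k s e x))"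

lemma secular_kernelD:
  fixes G :: "('v::finite, 'b, 'e::finite) mgraph"
  assumes "s \<in> secular_kernel G \<theta>"
  shows "(\<Sum>e | tail G e = v. fst (snd s) $ e) + (\<Sum>e | head G e = Inl v. snd (snd s) $ e) = 0"
    and "head G e = Inl w \<Longrightarrow>
      fst s $ w = fst s $ tail G e * cos (\<theta> $ e) + fst (snd s) $ e * sin (\<theta> $ e)"
    and "head G e = Inl w \<Longrightarrow>
      - (snd (snd s) $ e) = - (fst s $ tail G e) * sin (\<theta> $ e) + fst (snd s) $ e * cos (\<theta> $ e)"
    and "head G e = Inr b \<Longrightarrow>
      fst s $ tail G e * cos (\<theta> $ e) + fst (snd s) $ e * sin (\<theta> $ e) = 0"
  using assms unfolding secular_kernel_def by (auto simp: case_prod_beta)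

lemma graph_wave_edge_pt:
  fixes G :: "('v::finite, 'b, 'e::finite) mgraph"
  assumes "s \<in> secular_kernel G \<theta>" "phases_match k l \<theta>" "x \<in> {0..l $ e}"
  shows "graph_wave G k c s (edge_pt G l e x) = of_real (c * wave G k s e x)"
proof -
  consider "x = 0" | "0 < x" "x < l $ e" | "0 < x" "x = l $ e" using assms(3) by force
  thus ?thesis
  proof cases
    case 3
    show ?thesis
    proof (cases "head G e")
      case (Inl w)
      thus ?thesis
        using 3 secular_kernelD(2)[OF assms(1) Inl] phases_match_trig[OF assms(2), of e]
        by (simp add: graph_wave_def edge_pt_def wave_def)
    next
      case (Inr b)
      thus ?thesis
        using 3 secular_kernelD(4)[OF assms(1) Inr] phases_match_trig[OF assms(2), of e]
        by (simp add: graph_wave_def edge_pt_def wave_def)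
    qed
  qed (simp_all add: graph_wave_def edge_pt_def wave_def)
qed

text \<open>
  A phase vector enters the secular equations only through sines and cosines, so a state at \<open>\<theta>\<close> solves
  the matching conditions of the graph at every frequency \<open>k\<close> with \<open>k l = \<theta>\<close> modulo \<open>2\<pi>\<close>.
\<close>

lemma laplace_eq_graph_wave:
  fixes G :: "('v::finite, 'b, 'e::finite) mgraph"
  assumes s: "s \<in> secular_kernel G \<theta>" and ph: "phases_match k l \<theta>"
    and l: "edge_metric l"
  shows "laplace_eq G l (k\<^sup>2) (graph_wave G k c s)"
proof -
  define dw where "dw e x = k * (- (fst s $ tail G e) * sin (k * x) + fst (snd s) $ e * cos (k * x))"
    for e x
  define du :: "'e \<Rightarrow> real \<Rightarrow> complex" where "du e x = of_real (c * dw e x)" for e x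
  have d1: "((\<lambda>y. of_real (c * wave G k s e y) :: complex) has_vector_derivative du e x) (at x within S)"
    for e x S
    unfolding du_def
    by (rule has_vector_derivative_of_real)
       (auto simp: wave_def dw_def has_real_derivative_iff_has_vector_derivative[symmetric]
         intro!: derivative_eq_intros; simp add: algebra_simps)
  have d2: "(du e has_vector_derivative - (k\<^sup>2 *\<^sub>R of_real (c * wave G k s e x))) (at x within S)"
    for e x S
  proof -
    have "((\<lambda>y. of_real (c * dw e y) :: complex) has_vector_derivative
        of_real (- (k\<^sup>2 * (c * wave G k s e x)))) (at x within S)"
      by (rule has_vector_derivative_of_real)
         (auto simp: wave_def dw_def has_real_derivative_iff_has_vector_derivative[symmetric]
           intro!: derivative_eq_intros; simp add: algebra_simps power2_eq_square)
    moreover have "of_real (- (k\<^sup>2 * (c * wave G k s e x)))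
        = - (k\<^sup>2 *\<^sub>R (of_real (c * wave G k s e x) :: complex))"
      by (simp add: scaleR_conv_of_real)
    moreover have "du e = (\<lambda>y. of_real (c * dw e y))" by (auto simp: du_def)
    ultimately show ?thesis by simp
  qed
  have d1': "((\<lambda>y. graph_wave G k c s (edge_pt G l e y)) has_vector_derivative du e x)
      (at x within {0..l $ e})" if "x \<in> {0..l $ e}" for e x
    using that
    by (rule has_vector_derivative_transform[OF _ _ d1]) (rule graph_wave_edge_pt[OF s ph])
  have kirchhoff: "(\<Sum>e | tail G e = v. du e 0) + (\<Sum>e | head G e = Inl v. - du e (l $ e)) = 0" for v
  proof -
    have "(\<Sum>e | tail G e = v. du e 0) = of_real (c * k * (\<Sum>e | tail G e = v. fst (snd s) $ e))"
      by (simp add: du_def dw_def sum_distrib_left mult.assoc)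
    moreover have "- du e (l $ e) = of_real (c * k * snd (snd s) $ e)" if "head G e = Inl v" for e
      using secular_kernelD(3)[OF s that] phases_match_trig[OF ph, of e]
      by (simp add: du_def dw_def algebra_simps flip: of_real_minus of_real_mult)
    hence "(\<Sum>e | head G e = Inl v. - du e (l $ e))
        = of_real (c * k * (\<Sum>e | head G e = Inl v. snd (snd s) $ e))"
      by (simp add: sum_distrib_left)
    ultimately show ?thesis
      using secular_kernelD(1)[OF s, of v]
      by (simp only: flip: of_real_add distrib_left) simp
  qed
  show ?thesis
    unfolding laplace_eq_def
  proof (intro exI[of _ du] conjI allI ballI)
    fix e x assume x: "x \<in> {0..l $ e}"
    show "((\<lambda>y. graph_wave G k c s (edge_pt G l e y)) has_vector_derivative du e x)
      (at x within {0..l $ e})" using x by (rule d1')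
    show "(du e has_vector_derivative - (k\<^sup>2 *\<^sub>R graph_wave G k c s (edge_pt G l e x)))
      (at x within {0..l $ e})"
      unfolding graph_wave_edge_pt[OF s ph x] by (rule d2)
  next
    show "graph_wave G k c s (Vertex (Inr b)) = 0" for b by (simp add: graph_wave_def)
  qed (rule kirchhoff)
qed

text \<open>
  The primitive of \<open>(a cos(kt) + b sin(kt))\<^sup>2\<close> that vanishes at \<open>0\<close>.  Only its first summand survives
  as \<open>k\<close> tends to infinity.
\<close>

definition wave_mass :: "real \<Rightarrow> real \<Rightarrow> real \<Rightarrow> real \<Rightarrow> real" where
  "wave_mass k a b x = (a\<^sup>2 + b\<^sup>2) * x / 2 + (a\<^sup>2 - b\<^sup>2) * sin (2 * k * x) / (4 * k)
     + a * b * (1 - cos (2 * k * x)) / (2 * k)"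

lemma has_integral_wave_square:
  assumes "0 \<le> x" "0 < k"
  shows "((\<lambda>t. (a * cos (k * t) + b * sin (k * t))\<^sup>2) has_integral wave_mass k a b x) {0..x}"
proof -
  have "((\<lambda>t. (a * cos (k * t) + b * sin (k * t))\<^sup>2) has_integral
      (wave_mass k a b x - wave_mass k a b 0)) {0..x}"
  proof (rule fundamental_theorem_of_calculus)
    fix t assume "t \<in> {0..x}"
    have "(wave_mass k a b has_real_derivative
        (a\<^sup>2 + b\<^sup>2) / 2 + (a\<^sup>2 - b\<^sup>2) * cos (2 * k * t) / 2 + a * b * sin (2 * k * t))
        (at t within {0..x})"
      unfolding wave_mass_def using assms
      by (auto intro!: derivative_eq_intros simp: field_simps)
    moreover have "(a\<^sup>2 + b\<^sup>2) / 2 + (a\<^sup>2 - b\<^sup>2) * cos (2 * k * t) / 2 + a * b * sin (2 * k * t)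
        = (a * cos (k * t) + b * sin (k * t))\<^sup>2"
    proof -
      have "cos (2 * k * t) = (cos (k * t))\<^sup>2 - (sin (k * t))\<^sup>2"
        "sin (2 * k * t) = 2 * sin (k * t) * cos (k * t)"
        using cos_double[of "k * t"] sin_double[of "k * t"] by (simp_all add: mult.assoc)
      moreover have "(a\<^sup>2 + b\<^sup>2) / 2 = (a\<^sup>2 + b\<^sup>2) * ((sin (k * t))\<^sup>2 + (cos (k * t))\<^sup>2) / 2" by simp
      ultimately show ?thesis by algebra
    qed
    ultimately show "(wave_mass k a b has_vector_derivative (a * cos (k * t) + b * sin (k * t))\<^sup>2)
        (at t within {0..x})"
      by (simp add: has_real_derivative_iff_has_vector_derivative)
  qed (use assms in auto)
  thus ?thesis by (simp add: wave_mass_def)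
qed

lemma set_integral_wave_square:
  assumes "0 \<le> x" "0 < k" and S: "S = {0..x} \<or> S = {0<..x}"
  shows "(LINT t:S|lebesgue. (a * cos (k * t) + b * sin (k * t))\<^sup>2) = wave_mass k a b x"
proof -
  let ?f = "\<lambda>t. (a * cos (k * t) + b * sin (k * t))\<^sup>2"
  have "(?f has_integral wave_mass k a b x) S \<longleftrightarrow> (?f has_integral wave_mass k a b x) {0..x}"
  proof (rule has_integral_spike_set_eq)
    show "negligible {t \<in> S - {0..x}. ?f t \<noteq> 0}" 
    proof -
      have "{t \<in> S - {0..x}. ?f t \<noteq> 0} = {}" using S by auto
      thus ?thesis by (simp only: negligible_empty)
    qed
    show "negligible {t \<in> {0..x} - S. ?f t \<noteq> 0}"
    proof (rule negligible_subset[of "{0::real}"])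
      show "{t \<in> {0..x} - S. ?f t \<noteq> 0} \<subseteq> {0}"
      proof
        fix t assume "t \<in> {t \<in> {0..x} - S. ?f t \<noteq> 0}"
        hence "t \<in> {0..x} - S" by blast
        thus "t \<in> {0}" using S by auto
      qed
    qed simp
  qed
  hence hi: "(?f has_integral wave_mass k a b x) S"
    using has_integral_wave_square[OF assms(1,2)] by simp
  hence "?f absolutely_integrable_on S"
    by (intro nonnegative_absolutely_integrable_1) (auto simp: has_integral_integrable)
  thus ?thesis using hi by (simp add: set_lebesgue_integral_eq_integral(2) integral_unique)
qed

lemma L2_mass_on_graph_wave:
  fixes G :: "('v::finite, 'b, 'e::finite) mgraph"
  assumes s: "s \<in> secular_kernel G \<theta>" and ph: "phases_match k l \<theta>" and k: "0 < k"
    and a: "\<And>e. 0 \<le> a $ e" "\<And>e. a $ e \<le> l $ e"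
    and tr: "\<And>e. edge_trace G l \<omega> e = {0..a $ e} \<or> edge_trace G l \<omega> e = {0<..a $ e}"
  shows "L2_mass_on G l \<omega> (graph_wave G k c s)
      = c\<^sup>2 * (\<Sum>e\<in>UNIV. wave_mass k (fst s $ tail G e) (fst (snd s) $ e) (a $ e))"
proof -
  have "(LINT x:edge_trace G l \<omega> e|lebesgue. (cmod (graph_wave G k c s (edge_pt G l e x)))\<^sup>2)
      = c\<^sup>2 * wave_mass k (fst s $ tail G e) (fst (snd s) $ e) (a $ e)" for e
  proof -
    have "edge_trace G l \<omega> e \<in> sets lebesgue" using tr[of e] by auto
    moreover have "x \<in> {0..l $ e}" if "x \<in> edge_trace G l \<omega> e" for x
      using that by (simp add: edge_trace_def)
    ultimately have "(LINT x:edge_trace G l \<omega> e|lebesgue. (cmod (graph_wave G k c s (edge_pt G l e x)))\<^sup>2)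
      = (LINT x:edge_trace G l \<omega> e|lebesgue.
          c\<^sup>2 * (fst s $ tail G e * cos (k * x) + fst (snd s) $ e * sin (k * x))\<^sup>2)"
      using graph_wave_edge_pt[OF s ph, of _ e c]
      by (intro set_lebesgue_integral_cong)
         (auto simp: wave_def power_mult_distrib norm_of_real simp del: of_real_mult of_real_add)
    also have "\<dots> = c\<^sup>2 * (LINT x:edge_trace G l \<omega> e|lebesgue.
          (fst s $ tail G e * cos (k * x) + fst (snd s) $ e * sin (k * x))\<^sup>2)" by simp
    also have "\<dots> = c\<^sup>2 * wave_mass k (fst s $ tail G e) (fst (snd s) $ e) (a $ e)"
      by (subst set_integral_wave_square[OF a(1) k tr]) simp
    finally show ?thesis .
  qed
  thus ?thesis by (simp add: L2_mass_on_def integral_over_def sum_distrib_left)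
qed

lemma edge_trace_points:
  assumes "edge_metric l"
  shows "edge_trace G l (points l) e = {0..l $ e}"
  using assms by (auto simp: edge_trace_def points_def edge_pt_def edge_metric_def)

text \<open>
  Uniqueness of the two coefficients comes from evaluating at \<open>0\<close> and at one further point of the edge
  where the sine does not vanish; such a point exists because the edge has positive length.
\<close>

lemma intensity_graph_wave:
  fixes G :: "('v::finite, 'b, 'e::finite) mgraph"
  assumes s: "s \<in> secular_kernel G \<theta>" and ph: "phases_match k l \<theta>" and k: "0 < k"
    and l: "edge_metric l"
  shows "intensity G l k (graph_wave G k c s) = (c\<^sup>2 / 2) *\<^sub>R edge_energy G s"
proof -
  have "(THE q. \<exists>A B :: complex. (\<forall>x\<in>{0..l $ e}. graph_wave G k c s (edge_pt G l e x) =
        A * complex_of_real (cos (k * x)) + B * complex_of_real (sin (k * x))) \<and>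
     q = ((cmod A)\<^sup>2 + (cmod B)\<^sup>2) / 2) = c\<^sup>2 / 2 * ((fst s $ tail G e)\<^sup>2 + (fst (snd s) $ e)\<^sup>2)"
    (is "(THE q. ?P q) = ?q") for e
  proof (rule the_equality)
    let ?A = "complex_of_real (c * fst s $ tail G e)" and ?B = "complex_of_real (c * fst (snd s) $ e)"
    have rep: "graph_wave G k c s (edge_pt G l e x)
        = ?A * complex_of_real (cos (k * x)) + ?B * complex_of_real (sin (k * x))"
      if "x \<in> {0..l $ e}" for x
      unfolding graph_wave_edge_pt[OF s ph that] wave_def
      by (simp add: algebra_simps)
    show "?P ?q"
      by (intro exI[of _ ?A] exI[of _ ?B] conjI ballI rep)
         (auto simp: norm_mult power_mult_distrib algebra_simps)
    fix q assume "?P q"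
    then obtain A B :: complex where AB: "\<And>x. x \<in> {0..l $ e} \<Longrightarrow> graph_wave G k c s (edge_pt G l e x) =
        A * complex_of_real (cos (k * x)) + B * complex_of_real (sin (k * x))"
      and q: "q = ((cmod A)\<^sup>2 + (cmod B)\<^sup>2) / 2" by blast
    \<comment> \<open>The point used below lies in the edge and has a phase between \<open>0\<close> and \<open>1 < \<pi>\<close>.\<close>
    have l0: "0 < l $ e" using l by (simp add: edge_metric_def)
    have A: "A = ?A" using AB[of 0] rep[of 0] l0 by simp
    define x where "x = min (l $ e) (1 / k)"
    have "x \<le> 1 / k" by (simp add: x_def)
    hence "k * x \<le> 1" using k by (simp add: field_simps)
    hence x: "0 < x" "x \<le> l $ e" "k * x \<le> 1" using l0 k by (auto simp: x_def)
    have "0 < k * x" "k * x < pi" using x k pi_gt3 by auto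
    hence "sin (k * x) \<noteq> 0" using sin_gt_zero by force
    hence "B = ?B" using AB[of x] rep[of x] x A by simp
    thus "q = ?q" using A q by (simp add: norm_mult power_mult_distrib algebra_simps)
  qed
  thus ?thesis
    by (simp add: intensity_def edge_energy_def case_prod_beta vec_eq_iff)
qed

lemma wave_mass_tendsto:
  assumes k: "filterlim k at_top F" and "(a \<longlongrightarrow> a') F" "(b \<longlongrightarrow> b') F"
  shows "((\<lambda>n. wave_mass (k n) (a n) (b n) x) \<longlongrightarrow> (a'\<^sup>2 + b'\<^sup>2) * x / 2) F"
proof -
  have inv: "((\<lambda>n. 1 / k n) \<longlongrightarrow> 0) F"
    using tendsto_inverse_0_at_top[OF k] by (simp add: inverse_eq_divide)
  have s: "((\<lambda>n. sin (2 * k n * x) * (1 / k n)) \<longlongrightarrow> 0) F"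
    by (rule Lim_null_comparison[OF _ tendsto_norm_zero[OF inv]])
       (auto intro!: always_eventually divide_right_mono simp: abs_mult)
  have c: "((\<lambda>n. (1 - cos (2 * k n * x)) * (1 / k n)) \<longlongrightarrow> 0) F"
  proof (rule Lim_null_comparison[OF _ tendsto_mult_right_zero[OF tendsto_norm_zero[OF inv], of 2]])
    have "norm ((1 - cos y) * z) \<le> 2 * norm z" for y z :: real
    proof -
      have "\<bar>1 - cos y\<bar> \<le> 2" using cos_le_one[of y] cos_ge_minus_one[of y] by linarith
      thus ?thesis by (simp add: abs_mult mult_right_mono)
    qed
    thus "\<forall>\<^sub>F n in F. norm ((1 - cos (2 * k n * x)) * (1 / k n)) \<le> 2 * norm (1 / k n)"
      by (intro always_eventually allI)
  qed
  have "((\<lambda>n. ((a n)\<^sup>2 + (b n)\<^sup>2) * x / 2 + ((a n)\<^sup>2 - (b n)\<^sup>2) / 4 * (sin (2 * k n * x) * (1 / k n))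
     + a n * b n / 2 * ((1 - cos (2 * k n * x)) * (1 / k n)))
     \<longlongrightarrow> (a'\<^sup>2 + b'\<^sup>2) * x / 2 + (a'\<^sup>2 - b'\<^sup>2) / 4 * 0 + a' * b' / 2 * 0) F"
    by (intro tendsto_intros assms s c) simp_all
  thus ?thesis by (simp add: wave_mass_def)
qed

text \<open>
  Convergence of states along frequencies tending to infinity carries over to intensities and to
  observed masses: normalization divides by the total mass, which tends to \<open>l\<bullet>r / 2 > 0\<close>.  The first
  finitely many terms are dropped, since a frequency or a total mass among them need not be positive.
\<close>

lemma eigensequence:
  fixes G :: "('v::finite, 'b, 'e::finite) mgraph"
  assumes l: "edge_metric l" and k: "filterlim k at_top sequentially"
    and s: "\<And>n. s n \<in> secular_kernel G (\<theta> n)" and ph: "\<And>n. phases_match (k n) l (\<theta> n)"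
    and lim: "s \<longlonglongrightarrow> s'" and r: "r = edge_energy G s'" "0 < l \<bullet> r"
    and a: "\<And>e. 0 \<le> a $ e" "\<And>e. a $ e \<le> l $ e"
    and tr: "\<And>e. edge_trace G l \<omega> e = {0<..a $ e}"
  obtains k' :: "nat \<Rightarrow> real" and u
  where "filterlim k' at_top sequentially"
    and "\<And>n. k' n > 0" "\<And>n. laplace_eq G l ((k' n)\<^sup>2) (u n)" "\<And>n. L2_norm G l (u n) = 1"
    and "(\<lambda>n. intensity G l (k' n) (u n)) \<longlonglongrightarrow> (1 / (l \<bullet> r)) *\<^sub>R r"
    and "(\<lambda>n. L2_mass_on G l \<omega> (u n)) \<longlonglongrightarrow> (a \<bullet> r) / (l \<bullet> r)"
proof -
  define mass where "mass x n = (\<Sum>e\<in>UNIV. wave_mass (k n) (fst (s n) $ tail G e) (fst (snd (s n)) $ e) (x $ e))"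
    for x :: "real^'e" and n
  have lim1: "(\<lambda>n. fst (s n) $ v) \<longlonglongrightarrow> fst s' $ v" for v
    by (intro tendsto_vec_nth tendsto_fst lim)
  have lim2: "(\<lambda>n. fst (snd (s n)) $ e) \<longlonglongrightarrow> fst (snd s') $ e" for e
    by (intro tendsto_vec_nth tendsto_fst tendsto_snd lim)
  have r_nth: "r $ e = (fst s' $ tail G e)\<^sup>2 + (fst (snd s') $ e)\<^sup>2" for e
    by (simp add: r edge_energy_def case_prod_beta)
  have mass: "mass x \<longlonglongrightarrow> (x \<bullet> r) / 2" for x
  proof -
    have "mass x \<longlonglongrightarrow> (\<Sum>e\<in>UNIV. ((fst s' $ tail G e)\<^sup>2 + (fst (snd s') $ e)\<^sup>2) * x $ e / 2)"
      unfolding mass_def by (intro tendsto_sum wave_mass_tendsto k lim1 lim2)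
    also have "(\<Sum>e\<in>UNIV. ((fst s' $ tail G e)\<^sup>2 + (fst (snd s') $ e)\<^sup>2) * x $ e / 2) = (x \<bullet> r) / 2"
      by (simp add: inner_vec_def r_nth sum_divide_distrib mult.commute)
    finally show ?thesis .
  qed
  have "eventually (\<lambda>n. 0 < mass l n \<and> 0 < k n) sequentially"
    using order_tendstoD(1)[OF mass[of l], of 0] r(2) filterlim_at_top_dense[THEN iffD1, OF k, rule_format, of 0]
    by (intro eventually_conj) auto
  then obtain N where N: "\<And>n. N \<le> n \<Longrightarrow> 0 < mass l n \<and> 0 < k n"
    unfolding eventually_sequentially by blast
  define k' where "k' n = k (n + N)" for n
  define c where "c n = 1 / sqrt (mass l (n + N))" for n
  define u where "u n = graph_wave G (k' n) (c n) (s (n + N))" for n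
  have pos: "0 < mass l (n + N)" "0 < k' n" for n using N[of "n + N"] by (auto simp: k'_def)
  have c2: "(c n)\<^sup>2 = 1 / mass l (n + N)" for n
    using pos[of n] by (simp add: c_def power_divide)
  have ph': "phases_match (k' n) l (\<theta> (n + N))" for n using ph by (simp add: k'_def)
  have shift: "(\<lambda>n. mass x (n + N)) \<longlonglongrightarrow> (x \<bullet> r) / 2" for x
    using mass[of x] by (rule LIMSEQ_ignore_initial_segment)
  have "(\<lambda>n. (c n)\<^sup>2) \<longlonglongrightarrow> 1 / ((l \<bullet> r) / 2)"
    unfolding c2 using r(2) by (intro tendsto_divide shift) auto
  hence c2lim: "(\<lambda>n. (c n)\<^sup>2) \<longlonglongrightarrow> 2 / (l \<bullet> r)" by simp
  show ?thesis
  proof (rule that[of k' u])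
    show "filterlim k' at_top sequentially"
      unfolding k'_def using filterlim_compose[OF k filterlim_add_const_nat_at_top] .
    fix n
    show "0 < k' n" by (rule pos)
    show "laplace_eq G l ((k' n)\<^sup>2) (u n)"
      unfolding u_def by (rule laplace_eq_graph_wave[OF s ph' l])
    have "L2_mass_on G l (points l) (u n) = (c n)\<^sup>2 * mass l (n + N)"
      unfolding u_def mass_def k'_def[symmetric]
      using l by (intro L2_mass_on_graph_wave[OF s ph' pos(2)])
        (auto simp: edge_trace_points edge_metric_def less_imp_le)
    thus "L2_norm G l (u n) = 1" using pos(1)[of n] by (simp add: L2_norm_def c2)
  next
    have "edge_energy G (s (n + N)) = (\<chi> e. (fst (s (n + N)) $ tail G e)\<^sup>2 + (fst (snd (s (n + N))) $ e)\<^sup>2)" for n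
      by (simp add: edge_energy_def case_prod_beta)
    moreover have "(\<lambda>n. \<chi> e. (fst (s (n + N)) $ tail G e)\<^sup>2 + (fst (snd (s (n + N))) $ e)\<^sup>2) \<longlonglongrightarrow> r"
    proof (rule vec_tendstoI)
      show "(\<lambda>n. (\<chi> e. (fst (s (n + N)) $ tail G e)\<^sup>2 + (fst (snd (s (n + N))) $ e)\<^sup>2) $ e) \<longlonglongrightarrow> r $ e" for e
        unfolding r_nth vec_lambda_beta
        by (intro tendsto_intros LIMSEQ_ignore_initial_segment[OF lim1] LIMSEQ_ignore_initial_segment[OF lim2])
    qed
    ultimately have "(\<lambda>n. edge_energy G (s (n + N))) \<longlonglongrightarrow> r" by simp
    hence "(\<lambda>n. ((c n)\<^sup>2 / 2) *\<^sub>R edge_energy G (s (n + N))) \<longlonglongrightarrow> ((2 / (l \<bullet> r)) / 2) *\<^sub>R r"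
      by (intro tendsto_intros c2lim) auto
    moreover have "intensity G l (k' n) (u n) = ((c n)\<^sup>2 / 2) *\<^sub>R edge_energy G (s (n + N))" for n
      unfolding u_def by (rule intensity_graph_wave[OF s ph' pos(2) l])
    ultimately show "(\<lambda>n. intensity G l (k' n) (u n)) \<longlonglongrightarrow> (1 / (l \<bullet> r)) *\<^sub>R r" by simp
  next
    have "L2_mass_on G l \<omega> (u n) = (c n)\<^sup>2 * mass a (n + N)" for n
      unfolding u_def mass_def k'_def[symmetric]
      using tr by (intro L2_mass_on_graph_wave[OF s ph' pos(2) a]) auto
    moreover have "(\<lambda>n. (c n)\<^sup>2 * mass a (n + N)) \<longlonglongrightarrow> 2 / (l \<bullet> r) * ((a \<bullet> r) / 2)"
      by (intro tendsto_intros c2lim shift)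
    ultimately show "(\<lambda>n. L2_mass_on G l \<omega> (u n)) \<longlonglongrightarrow> (a \<bullet> r) / (l \<bullet> r)" by simp
  qed
qed

section \<open>An upper bound for the localization constant\<close>

lemma L2_mass_on_nonneg: "0 \<le> L2_mass_on G l \<omega> u"
  unfolding L2_mass_on_def integral_over_def set_lebesgue_integral_def
  by (intro sum_nonneg integral_nonneg_AE) auto

text \<open>
  The infima increase with the spectral threshold, and the sequence keeps every one of them below
  the limiting mass.  Hence the limit exists and obeys the same bound.
\<close>

lemma C_infinity_le_limit:
  fixes G :: "('v, 'b, 'e::finite) mgraph"
  assumes k: "filterlim k at_top sequentially"
    and u: "\<And>n. laplace_eq G l ((k n)\<^sup>2) (u n)" "\<And>n. L2_norm G l (u n) = 1"
    and lim: "(\<lambda>n. L2_mass_on G l \<omega> (u n)) \<longlonglongrightarrow> m"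
  shows "C_infinity G l \<omega> \<le> m"
proof -
  define S where "S \<Lambda> = {L2_mass_on G l \<omega> u | u \<mu>. laplace_eq G l \<mu> u \<and> \<Lambda> \<le> \<mu> \<and> L2_norm G l u = 1}"
    for \<Lambda> :: real
  have bdd: "bdd_below (S \<Lambda>)" for \<Lambda>
    by (rule bdd_belowI[of _ 0]) (auto simp: S_def L2_mass_on_nonneg)
  have k2: "filterlim (\<lambda>n. (k n)\<^sup>2) at_top sequentially"
    using filterlim_pow_at_top[OF _ k, of 2] by simp
  have S_ev: "eventually (\<lambda>n. L2_mass_on G l \<omega> (u n) \<in> S \<Lambda>) sequentially" for \<Lambda>
    using filterlim_at_top[THEN iffD1, OF k2, rule_format, of \<Lambda>]
    by eventually_elim (use u in \<open>auto simp: S_def\<close>)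
  have nonempty: "S \<Lambda> \<noteq> {}" for \<Lambda> using eventually_happens[OF S_ev[of \<Lambda>]] by auto
  have Inf_le: "Inf (S \<Lambda>) \<le> m" for \<Lambda>
  proof (rule tendsto_lowerbound[OF lim])
    show "eventually (\<lambda>n. Inf (S \<Lambda>) \<le> L2_mass_on G l \<omega> (u n)) sequentially"
      using S_ev[of \<Lambda>] by eventually_elim (rule cInf_lower[OF _ bdd])
  qed simp
  have mono: "Inf (S \<Lambda>) \<le> Inf (S \<Lambda>')" if "\<Lambda> \<le> \<Lambda>'" for \<Lambda> \<Lambda>'
    using that by (intro cInf_superset_mono nonempty bdd) (fastforce simp: S_def)
  have above: "bdd_above (range (\<lambda>\<Lambda>. Inf (S \<Lambda>)))"
    by (rule bdd_aboveI[of _ m]) (auto simp: Inf_le)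
  have "((\<lambda>\<Lambda>. Inf (S \<Lambda>)) \<longlongrightarrow> (SUP \<Lambda>. Inf (S \<Lambda>))) at_top"
  proof (rule increasing_tendsto)
    show "eventually (\<lambda>\<Lambda>. Inf (S \<Lambda>) \<le> (SUP \<Lambda>. Inf (S \<Lambda>))) at_top"
      by (intro always_eventually allI cSUP_upper above) simp
    fix x assume "x < (SUP \<Lambda>. Inf (S \<Lambda>))"
    then obtain \<Lambda>0 where "x < Inf (S \<Lambda>0)" using less_cSUP_iff[OF _ above] by auto
    hence "x < Inf (S \<Lambda>)" if "\<Lambda>0 \<le> \<Lambda>" for \<Lambda> using mono[OF that] by linarith
    thus "eventually (\<lambda>\<Lambda>. x < Inf (S \<Lambda>)) at_top" unfolding eventually_at_top_linorder by blast
  qed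
  hence "C_infinity G l \<omega> = (SUP \<Lambda>. Inf (S \<Lambda>))"
    unfolding C_infinity_def S_def[symmetric] by (intro tendsto_Lim) auto
  also have "\<dots> \<le> m" by (rule cSUP_least) (auto simp: Inf_le)
  finally show ?thesis .
qed

section \<open>Observation sets with prescribed lengths\<close>

definition initial_segments :: "real^'e \<Rightarrow> ('v, 'b, 'e) gpoint set" where
  "initial_segments a = {Inner e x | e x. 0 < x \<and> x \<le> a $ e}"

lemma initial_segments:
  fixes G :: "('v, 'b, 'e::finite) mgraph"
  assumes "\<And>e. 0 < a $ e" "\<And>e. a $ e < l $ e"
  shows "edge_trace G l (initial_segments a) e = {0<..a $ e}"
    and "measurable_subset G l (initial_segments a)"
    and "obs_lengths G l (initial_segments a) = a"
proof -
  have tr: "edge_trace G l (initial_segments a) e = {0<..a $ e}" for e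
    using assms[of e] by (auto simp: edge_trace_def edge_pt_def initial_segments_def)
  thus "edge_trace G l (initial_segments a) e = {0<..a $ e}" .
  have "x < l $ e" if "x \<le> a $ e" for x e using that assms(2)[of e] by linarith
  thus "measurable_subset G l (initial_segments a)"
    by (auto simp: measurable_subset_def tr) (auto simp: initial_segments_def points_def)
  show "obs_lengths G l (initial_segments a) = a"
    using assms(1) by (simp add: obs_lengths_def tr vec_eq_iff less_imp_le)
qed

text \<open>
  Every component of \<open>d\<close> is bounded by its norm, so a multiple of \<open>d\<close> that is small against the
  shortest edge stays within half of each edge.
\<close>

lemma admissible_perturbation:
  fixes l d :: "real^'e::finite"
  assumes "edge_metric l"
  obtains \<epsilon> :: real where "0 < \<epsilon>" "\<And>e. 0 < ((1/2) *\<^sub>R l + \<epsilon> *\<^sub>R d) $ e"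
    "\<And>e. ((1/2) *\<^sub>R l + \<epsilon> *\<^sub>R d) $ e < l $ e"
proof -
  define m where "m = Min (range (($) l))"
  have m: "0 < m" "\<And>e. m \<le> l $ e"
    using assms unfolding m_def edge_metric_def by (auto simp: Min_gr_iff)
  define \<epsilon> where "\<epsilon> = (m / 2) / (norm d + 1)"
  have nd: "0 < norm d + 1" by (simp add: add_nonneg_pos)
  have \<epsilon>: "0 < \<epsilon>" using m nd by (simp add: \<epsilon>_def)
  have "\<epsilon> * (norm d + 1) = m / 2"
    using nd nonzero_eq_divide_eq[THEN iffD1, OF _ \<epsilon>_def] by force
  hence small: "\<epsilon> * norm d < m / 2" using \<epsilon> by (simp add: algebra_simps)
  have "\<bar>\<epsilon> * d $ e\<bar> < l $ e / 2" for e
  proof -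
    have "\<bar>\<epsilon> * d $ e\<bar> \<le> \<epsilon> * norm d"
      using \<epsilon> component_le_norm_cart[of d e] by (simp add: abs_mult)
    thus ?thesis using small m(2)[of e] by linarith
  qed
  note bound = this
  have comp: "((1/2) *\<^sub>R l + \<epsilon> *\<^sub>R d) $ e = l $ e / 2 + \<epsilon> * d $ e" for e by simp
  show ?thesis
  proof (rule that[OF \<epsilon>], unfold comp)
    show "0 < l $ e / 2 + \<epsilon> * d $ e" "l $ e / 2 + \<epsilon> * d $ e < l $ e" for e
      using bound[of e] by linarith+
  qed
qed

section \<open>A lower bound for the singular-completion constant\<close>

definition hadamard_square :: "real^'e \<Rightarrow> real^'e" where
  "hadamard_square A = (\<chi> e. (A $ e)\<^sup>2)"

text \<open>
  The matrix \<open>B_bc\<close> as a function of the parities in place of the phases.  The parities range over a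
  compact set, the phases do not.
\<close>

definition parity_matrix :: "('v, 'b, 'e) mgraph \<Rightarrow> real^'e \<Rightarrow> real^'e^'v" where
  "parity_matrix G \<sigma> = (\<chi> v e.
     (if tail G e = v then 1 else 0) - (if head G e = Inl v then \<sigma> $ e else 0))"

lemma sector_parities:
  "(\<exists>\<theta>. singular_sector \<theta> \<and> (\<forall>e. cos (\<theta> $ e) = \<sigma> $ e)) \<longleftrightarrow> (\<forall>e. (\<sigma> $ e)\<^sup>2 = 1)"
proof
  assume "\<exists>\<theta>. singular_sector \<theta> \<and> (\<forall>e. cos (\<theta> $ e) = \<sigma> $ e)"
  then obtain \<theta> where \<theta>: "singular_sector \<theta>" "\<And>e. cos (\<theta> $ e) = \<sigma> $ e" by blast
  have "(cos (\<theta> $ e))\<^sup>2 = 1" for e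
  proof -
    obtain n :: int where "\<theta> $ e = of_int n * pi"
      using \<theta>(1) unfolding singular_sector_def pi_multiples_def by blast
    hence "sin (\<theta> $ e) = 0" by (simp add: sin_zero_iff_int2)
    thus ?thesis by (simp add: cos_squared_eq)
  qed
  thus "\<forall>e. (\<sigma> $ e)\<^sup>2 = 1" using \<theta>(2) by simp
next
  assume \<sigma>: "\<forall>e. (\<sigma> $ e)\<^sup>2 = 1"
  define \<theta> :: "real^'a" where "\<theta> = (\<chi> e. if \<sigma> $ e = 1 then 0 else pi)"
  have "\<theta> $ e \<in> pi_multiples" for e
    unfolding pi_multiples_def \<theta>_def
    by (cases "\<sigma> $ e = 1") (auto intro: image_eqI[of _ _ 0] image_eqI[of _ _ 1])
  moreover have "cos (\<theta> $ e) = \<sigma> $ e" for e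
    using \<sigma>[rule_format, of e] by (auto simp: \<theta>_def power2_eq_1_iff)
  ultimately show "\<exists>\<theta>. singular_sector \<theta> \<and> (\<forall>e. cos (\<theta> $ e) = \<sigma> $ e)"
    unfolding singular_sector_def by blast
qed

lemma M_bc_generators:
  fixes G :: "('v::finite, 'b, 'e::finite) mgraph"
  shows "M_bc G = convex_cone hull
    {hadamard_square A | A \<sigma>. (\<forall>e. (\<sigma> $ e)\<^sup>2 = 1) \<and> parity_matrix G \<sigma> *v A = 0}"
proof -
  have B: "B_bc G \<theta> = parity_matrix G \<sigma>" if "\<forall>e. cos (\<theta> $ e) = \<sigma> $ e" for \<theta> \<sigma>
    using that by (simp add: B_bc_def parity_matrix_def vec_eq_iff)
  have "(\<exists>\<theta>. singular_sector \<theta> \<and> B_bc G \<theta> *v A = 0)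
      \<longleftrightarrow> (\<exists>\<sigma>. (\<forall>e. (\<sigma> $ e)\<^sup>2 = 1) \<and> parity_matrix G \<sigma> *v A = 0)" for A
  proof
    assume "\<exists>\<theta>. singular_sector \<theta> \<and> B_bc G \<theta> *v A = 0"
    then obtain \<theta> where \<theta>: "singular_sector \<theta>" "B_bc G \<theta> *v A = 0" by blast
    have c: "\<forall>e. cos (\<theta> $ e) = (\<chi> e. cos (\<theta> $ e)) $ e" by simp
    show "\<exists>\<sigma>. (\<forall>e. (\<sigma> $ e)\<^sup>2 = 1) \<and> parity_matrix G \<sigma> *v A = 0"
      using \<theta> c B[OF c] sector_parities[THEN iffD1, OF exI, OF conjI, OF \<theta>(1) c] by metis
  next
    assume "\<exists>\<sigma>. (\<forall>e. (\<sigma> $ e)\<^sup>2 = 1) \<and> parity_matrix G \<sigma> *v A = 0"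
    then obtain \<sigma> where \<sigma>: "\<forall>e. (\<sigma> $ e)\<^sup>2 = 1" "parity_matrix G \<sigma> *v A = 0" by blast
    then obtain \<theta> where "singular_sector \<theta>" "\<forall>e. cos (\<theta> $ e) = \<sigma> $ e"
      using sector_parities[of \<sigma>] by blast
    thus "\<exists>\<theta>. singular_sector \<theta> \<and> B_bc G \<theta> *v A = 0" using \<sigma>(2) B by metis
  qed
  hence "{(\<chi> e. (A $ e)\<^sup>2) | A \<theta>. singular_sector \<theta> \<and> B_bc G \<theta> *v A = 0}
      = {hadamard_square A | A \<sigma>. (\<forall>e. (\<sigma> $ e)\<^sup>2 = 1) \<and> parity_matrix G \<sigma> *v A = 0}"
    unfolding hadamard_square_def by blast
  thus ?thesis by (simp add: M_bc_def)
qed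

lemma inner_hadamard_pos:
  assumes "edge_metric l" "A \<noteq> 0"
  shows "0 < l \<bullet> hadamard_square A"
proof -
  obtain e where e: "A $ e \<noteq> 0" using assms(2) by (auto simp: vec_eq_iff)
  have "0 < l $ e * (A $ e)\<^sup>2" using assms(1) e by (simp add: edge_metric_def)
  also have "\<dots> \<le> (\<Sum>e\<in>UNIV. l $ e * (A $ e)\<^sup>2)"
    using assms(1) by (intro member_le_sum) (auto simp: edge_metric_def less_imp_le)
  finally show ?thesis by (simp add: inner_vec_def hadamard_square_def)
qed

text \<open>
  The set \<open>K\<close> of pairs of an admissible amplitude vector, normalized by \<open>l\<close>, and a parity vector is
  compact, so \<open>\<alpha>\<bullet>A\<^sup>2\<close> attains a minimum \<open>c\<close> on it.  By scaling, all generators lie in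
  the half-space \<open>(\<alpha> - c l)\<bullet>s \<ge> 0\<close>.  This half-space is a convex cone, so it contains \<open>M_bc\<close>, and
  the minimum over the whole cone is the minimum over the generators.
\<close>

lemma C_sing_gt:
  fixes G :: "('v::finite, 'b, 'e::finite) mgraph" and c0 :: real
  assumes l: "edge_metric l"
    and pos: "\<And>A \<sigma>. A \<noteq> 0 \<Longrightarrow> \<forall>e. (\<sigma> $ e)\<^sup>2 = 1 \<Longrightarrow> parity_matrix G \<sigma> *v A = 0 \<Longrightarrow>
      c0 * (l \<bullet> hadamard_square A) < obs_lengths G l \<omega> \<bullet> hadamard_square A"
    and ex: "A1 \<noteq> 0" "\<forall>e. (\<sigma>1 $ e)\<^sup>2 = 1" "parity_matrix G \<sigma>1 *v A1 = 0"
  shows "c0 < C_sing G l \<omega>"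
proof -
  define \<alpha> where "\<alpha> = obs_lengths G l \<omega>"
  define K :: "((real^'e) \<times> (real^'e)) set" where
    "K = {z. (\<forall>e. (snd z $ e)\<^sup>2 = 1) \<and> (\<forall>v. (parity_matrix G (snd z) *v fst z) $ v = 0)
      \<and> l \<bullet> hadamard_square (fst z) = 1}"
  have normalize: "\<exists>t>0. (t *\<^sub>R A, \<sigma>) \<in> K \<and> t\<^sup>2 * (l \<bullet> hadamard_square A) = 1"
    if "A \<noteq> 0" "\<forall>e. (\<sigma> $ e)\<^sup>2 = 1" "parity_matrix G \<sigma> *v A = 0" for A \<sigma>
  proof -
    define t where "t = 1 / sqrt (l \<bullet> hadamard_square A)"
    have p: "0 < l \<bullet> hadamard_square A" by (rule inner_hadamard_pos[OF l that(1)])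
    have t: "0 < t" "t\<^sup>2 * (l \<bullet> hadamard_square A) = 1"
      using p by (auto simp: t_def power_divide)
    have "hadamard_square (t *\<^sub>R A) = t\<^sup>2 *\<^sub>R hadamard_square A"
      by (simp add: hadamard_square_def vec_eq_iff power_mult_distrib)
    moreover have "parity_matrix G \<sigma> *v (t *\<^sub>R A) = 0"
      using that(3) by (simp add: matrix_vector_mult_scaleR)
    ultimately have "(t *\<^sub>R A, \<sigma>) \<in> K" using that t by (simp add: K_def)
    thus ?thesis using t by blast
  qed
  have entry: "continuous_on UNIV (\<lambda>z :: (real^'e) \<times> (real^'e). if P then snd z $ e else 0)" for P e
    by (cases P) (auto intro!: continuous_intros)
  have "closed K"
    unfolding K_def hadamard_square_def parity_matrix_def matrix_vector_mult_def inner_vec_def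
      vec_lambda_beta
    by (intro closed_Collect_conj closed_Collect_all closed_Collect_eq continuous_intros entry)
  moreover have "bounded K"
  proof (rule bounded_subset)
    define R where "R = (\<Sum>e\<in>UNIV. sqrt (1 / l $ e))"
    show "bounded (cball (0::real^'e) R \<times> cball (0::real^'e) (real CARD('e)))"
      by (intro bounded_Times bounded_cball)
    show "K \<subseteq> cball 0 R \<times> cball 0 (real CARD('e))"
    proof
      fix z assume z: "z \<in> K"
      have "\<bar>fst z $ e\<bar> \<le> sqrt (1 / l $ e)" for e
      proof -
        have le: "0 < l $ e" using l by (simp add: edge_metric_def)
        have "l $ e * (fst z $ e)\<^sup>2 \<le> (\<Sum>e\<in>UNIV. l $ e * (fst z $ e)\<^sup>2)"
          using l by (intro member_le_sum) (auto simp: edge_metric_def less_imp_le)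
        also have "\<dots> = 1" using z by (simp add: K_def inner_vec_def hadamard_square_def)
        finally have "(fst z $ e)\<^sup>2 \<le> 1 / l $ e" using le by (simp add: field_simps)
        thus ?thesis using real_sqrt_le_mono real_sqrt_abs by metis
      qed
      hence "norm (fst z) \<le> R"
        unfolding R_def by (intro order_trans[OF norm_le_l1_cart] sum_mono)
      moreover have "\<bar>snd z $ e\<bar> = 1" for e
      proof -
        have "(snd z $ e)\<^sup>2 = 1" using z by (simp add: K_def)
        thus ?thesis by (auto simp: power2_eq_1_iff)
      qed
      hence "norm (snd z) \<le> real CARD('e)"
        using norm_le_l1_cart[of "snd z"] by simp
      ultimately show "z \<in> cball 0 R \<times> cball 0 (real CARD('e))" by (simp add: mem_Times_iff)
    qed
  qed
  ultimately have "compact K" by (simp add: compact_eq_bounded_closed)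
  moreover have "K \<noteq> {}" using normalize[OF ex] by blast
  moreover have "continuous_on K (\<lambda>z. \<alpha> \<bullet> hadamard_square (fst z))"
    unfolding hadamard_square_def inner_vec_def vec_lambda_beta
    by (auto intro!: continuous_intros)
  ultimately obtain z where z: "z \<in> K"
    and min: "\<And>y. y \<in> K \<Longrightarrow> \<alpha> \<bullet> hadamard_square (fst z) \<le> \<alpha> \<bullet> hadamard_square (fst y)"
    using continuous_attains_inf[of K] by blast
  define c where "c = \<alpha> \<bullet> hadamard_square (fst z)"
  have zK: "\<forall>e. (snd z $ e)\<^sup>2 = 1" "parity_matrix G (snd z) *v fst z = 0"
    "l \<bullet> hadamard_square (fst z) = 1"
    using z by (auto simp: K_def vec_eq_iff)
  have "fst z \<noteq> 0" using zK(3) by (auto simp: hadamard_square_def inner_vec_def)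
  hence c: "c0 < c" using pos[OF _ zK(1,2)] zK(3) by (simp add: c_def \<alpha>_def)
  have "C_sing G l \<omega> = c"
    unfolding C_sing_def \<alpha>_def[symmetric]
  proof (rule Least_equality)
    have "hadamard_square (fst z) \<in> M_bc G"
      unfolding M_bc_generators by (rule hull_inc) (use zK in blast)
    thus "\<exists>s\<in>M_bc G. l \<bullet> s = 1 \<and> c = \<alpha> \<bullet> s" using zK(3) c_def by blast
  next
    have "M_bc G \<subseteq> {s. (\<alpha> - c *\<^sub>R l) \<bullet> s \<ge> 0}"
      unfolding M_bc_generators
    proof (rule hull_minimal)
      show "{hadamard_square A | A \<sigma>. (\<forall>e. (\<sigma> $ e)\<^sup>2 = 1) \<and> parity_matrix G \<sigma> *v A = 0}
        \<subseteq> {s. (\<alpha> - c *\<^sub>R l) \<bullet> s \<ge> 0}"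
      proof clarify
        fix A \<sigma> :: "real^'e" assume A: "\<forall>e. (\<sigma> $ e)\<^sup>2 = 1" "parity_matrix G \<sigma> *v A = 0"
        show "0 \<le> (\<alpha> - c *\<^sub>R l) \<bullet> hadamard_square A"
        proof (cases "A = 0")
          case False
          obtain t where t: "t > 0" "(t *\<^sub>R A, \<sigma>) \<in> K" "t\<^sup>2 * (l \<bullet> hadamard_square A) = 1"
            using normalize[OF False A] by blast
          have "hadamard_square (t *\<^sub>R A) = t\<^sup>2 *\<^sub>R hadamard_square A"
            by (simp add: hadamard_square_def vec_eq_iff power_mult_distrib)
          hence "c \<le> t\<^sup>2 * (\<alpha> \<bullet> hadamard_square A)" using min[OF t(2)] by (simp add: c_def)
          hence "0 \<le> t\<^sup>2 * (\<alpha> \<bullet> hadamard_square A) - c * (t\<^sup>2 * (l \<bullet> hadamard_square A))"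
            using t(3) by simp
          also have "\<dots> = t\<^sup>2 * ((\<alpha> - c *\<^sub>R l) \<bullet> hadamard_square A)"
            by (simp add: inner_diff_left algebra_simps)
          finally show ?thesis using t(1) by (simp add: zero_le_mult_iff)
        qed (simp add: hadamard_square_def inner_vec_def)
      qed
    qed (rule convex_cone_halfspace_ge)
    hence "c * (l \<bullet> s) \<le> \<alpha> \<bullet> s" if "s \<in> M_bc G" for s
      using that by (auto simp: inner_diff_left)
    thus "c \<le> y" if "\<exists>s\<in>M_bc G. l \<bullet> s = 1 \<and> y = \<alpha> \<bullet> s" for y using that by fastforce
  qed
  thus ?thesis using c by simp
qed

section \<open>Combinatorics of the crossed graph\<close>

lemma sum_edge: "(\<Sum>e\<in>UNIV. f e) = f e13 + f e14 + f eext2 + f eext4 + f e12 + f e23 + f e34"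
  for f :: "edge \<Rightarrow> 'a::comm_monoid_add"
  by (simp add: UNIV_edge add.assoc)

lemma all_edges: "(\<forall>e. P e) \<longleftrightarrow> P e13 \<and> P e14 \<and> P eext2 \<and> P eext4 \<and> P e12 \<and> P e23 \<and> P e34"
  by (metis edge.exhaust)

text \<open>
  Every vertex is joined to \<open>v1\<close> by a path of at most two edges.
\<close>

lemma connected_cross: "(x, y) \<in> (adjacency G_cross)\<^sup>*"
proof -
  have edge: "(Inl (tail G_cross e), head G_cross e) \<in> adjacency G_cross"
    "(head G_cross e, Inl (tail G_cross e)) \<in> adjacency G_cross" for e
    by (auto simp: adjacency_def)
  have nb: "(Inl v1, z) \<in> (adjacency G_cross)\<^sup>* \<and> (z, Inl v1) \<in> (adjacency G_cross)\<^sup>*"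
    if "(Inl v1, Inl (tail G_cross e)) \<in> (adjacency G_cross)\<^sup>*"
      "(Inl (tail G_cross e), Inl v1) \<in> (adjacency G_cross)\<^sup>*" "z = head G_cross e" for e z
    using that edge[of e] by (meson r_into_rtrancl rtrancl_trans)
  have v2: "(Inl v1, Inl v2) \<in> (adjacency G_cross)\<^sup>* \<and> (Inl v2, Inl v1) \<in> (adjacency G_cross)\<^sup>*"
    by (rule nb[of e12]) (simp_all add: G_cross_def)
  have v3: "(Inl v1, Inl v3) \<in> (adjacency G_cross)\<^sup>* \<and> (Inl v3, Inl v1) \<in> (adjacency G_cross)\<^sup>*"
    by (rule nb[of e13]) (simp_all add: G_cross_def)
  have v4: "(Inl v1, Inl v4) \<in> (adjacency G_cross)\<^sup>* \<and> (Inl v4, Inl v1) \<in> (adjacency G_cross)\<^sup>*"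
    by (rule nb[of e14]) (simp_all add: G_cross_def)
  have b2: "(Inl v1, Inr b2) \<in> (adjacency G_cross)\<^sup>* \<and> (Inr b2, Inl v1) \<in> (adjacency G_cross)\<^sup>*"
    using v2 by (intro nb[of eext2]) (simp_all add: G_cross_def)
  have b4: "(Inl v1, Inr b4) \<in> (adjacency G_cross)\<^sup>* \<and> (Inr b4, Inl v1) \<in> (adjacency G_cross)\<^sup>*"
    using v4 by (intro nb[of eext4]) (simp_all add: G_cross_def)
  have "(Inl v1, z) \<in> (adjacency G_cross)\<^sup>* \<and> (z, Inl v1) \<in> (adjacency G_cross)\<^sup>*" for z
  proof (cases z)
    case (Inl v) thus ?thesis using v2 v3 v4 by (cases v) auto
  next
    case (Inr b) thus ?thesis using b2 b4 by (cases b) auto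
  qed
  thus ?thesis by (meson rtrancl_trans)
qed

lemma cards: "CARD(edge) = 7" "CARD(ext) = 2" "CARD(vtx) = 4"
  by (simp_all add: UNIV_edge UNIV_ext UNIV_vtx)

lemma admissible_cross: "admissible_graph G_cross"
  unfolding admissible_graph_def
proof (intro conjI allI)
  show "connected_graph G_cross" by (simp add: connected_graph_def connected_cross)
  have "head G_cross e = Inr b \<longleftrightarrow> e = (case b of b2 \<Rightarrow> eext2 | b4 \<Rightarrow> eext4)" for e b
    by (cases e; cases b) (simp_all add: G_cross_def)
  thus "\<exists>!e. head G_cross e = Inr b" for b by simp
qed

lemma cycle_rank_cross: "cycle_rank G_cross = 2"
proof -
  have "(adjacency G_cross)\<^sup>* = UNIV" using connected_cross by auto
  hence "UNIV // (adjacency G_cross)\<^sup>* = {UNIV}" by (auto simp: quotient_def)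
  thus ?thesis by (simp add: cycle_rank_def cards)
qed

section \<open>Singular profiles of the crossed graph\<close>

text \<open>
  Sylvester's criterion in dimension three.  Completing squares without division expresses the
  form, multiplied by its first two leading minors, as a sum of squares weighted by products of the
  leading minors.
\<close>

lemma ternary_form_positive:
  fixes a11 a12 a13 a22 a23 a33 x y z :: real
  assumes "0 < a11" and D2: "0 < a11 * a22 - a12\<^sup>2"
    and D3: "0 < a11 * a22 * a33 + 2 * a12 * a13 * a23 - a11 * a23\<^sup>2 - a22 * a13\<^sup>2 - a33 * a12\<^sup>2"
    and ne: "x \<noteq> 0 \<or> y \<noteq> 0 \<or> z \<noteq> 0"
  shows "0 < a11 * x\<^sup>2 + a22 * y\<^sup>2 + a33 * z\<^sup>2 + 2 * a12 * x * y + 2 * a13 * x * z + 2 * a23 * y * z"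
    (is "0 < ?Q")
proof -
  define D2 where "D2 = a11 * a22 - a12\<^sup>2"
  define D3 where "D3 = a11 * a22 * a33 + 2 * a12 * a13 * a23 - a11 * a23\<^sup>2 - a22 * a13\<^sup>2 - a33 * a12\<^sup>2"
  define L1 where "L1 = a11 * x + a12 * y + a13 * z"
  define L2 where "L2 = D2 * y + (a11 * a23 - a12 * a13) * z"
  have D: "0 < D2" "0 < D3" using assms by (auto simp: D2_def D3_def)
  \<comment> \<open>\<open>L1\<close> and \<open>L2\<close> are the pivot rows of fraction-free elimination.\<close>
  have id: "a11 * D2 * ?Q = D2 * L1\<^sup>2 + L2\<^sup>2 + a11 * D3 * z\<^sup>2"
    unfolding D2_def D3_def L1_def L2_def by algebra
  have "0 < D2 * L1\<^sup>2 + L2\<^sup>2 + a11 * D3 * z\<^sup>2"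
  proof (rule ccontr)
    assume neg: "\<not> ?thesis"
    have nn: "0 \<le> D2 * L1\<^sup>2" "0 \<le> L2\<^sup>2" "0 \<le> a11 * D3 * z\<^sup>2" using D assms(1) by auto
    have "a11 * D3 * z\<^sup>2 = 0" "L2\<^sup>2 = 0" "D2 * L1\<^sup>2 = 0" using nn neg by linarith+
    hence "z = 0" "L2 = 0" "L1 = 0" using D assms(1) by auto
    hence "z = 0" "y = 0" "x = 0" using D assms(1) by (auto simp: L1_def L2_def)
    thus False using ne by simp
  qed
  hence "0 < a11 * D2 * ?Q" by (simp only: id)
  moreover have "0 < a11 * D2" using D assms(1) by simp
  ultimately show ?thesis by (simp only: zero_less_mult_pos)
qed

lemma parity_kernel_cross:
  assumes "parity_matrix G_cross \<sigma> *v A = 0"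
  shows "A $ e12 = - (A $ e13 + A $ e14)"
    "A $ eext2 = \<sigma> $ e12 * A $ e12 - A $ e23"
    "A $ e34 = \<sigma> $ e13 * A $ e13 + \<sigma> $ e23 * A $ e23"
    "A $ eext4 = \<sigma> $ e14 * A $ e14 + \<sigma> $ e34 * A $ e34"
proof -
  have "(parity_matrix G_cross \<sigma> *v A) $ v = 0" for v using assms by simp
  note row = this[unfolded parity_matrix_def matrix_vector_mult_def vec_lambda_beta sum_edge]
  show "A $ e12 = - (A $ e13 + A $ e14)" using row[of v1] by (simp add: G_cross_def)
  show "A $ eext2 = \<sigma> $ e12 * A $ e12 - A $ e23" using row[of v2] by (simp add: G_cross_def)
  show "A $ e34 = \<sigma> $ e13 * A $ e13 + \<sigma> $ e23 * A $ e23" using row[of v3] by (simp add: G_cross_def)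
  show "A $ eext4 = \<sigma> $ e14 * A $ e14 + \<sigma> $ e34 * A $ e34" using row[of v4] by (simp add: G_cross_def)
qed

text \<open>
  Replacing \<open>A\<^sub>2\<^sub>3\<close> by \<open>z = \<sigma>\<^sub>1\<^sub>2 A\<^sub>2\<^sub>3\<close> and factoring signs out of the dependent amplitudes leaves only two
  parities \<open>a\<close> and \<open>b\<close> in the squares: the parity products around the cycles \<open>v1 v3 v4\<close> and \<open>v1 v2 v3 v4\<close>.
  Both are cycle invariants, as a change of sign at a vertex does not affect them.
  The four resulting forms in \<open>x, y, z\<close> are positive definite.
\<close>

lemma d_hat_positive_on_singular:
  assumes A: "A \<noteq> 0" and \<sigma>: "\<forall>e. (\<sigma> $ e)\<^sup>2 = 1" and ker: "parity_matrix G_cross \<sigma> *v A = 0"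
  shows "0 < d_hat \<bullet> hadamard_square A"
proof -
  note K = parity_kernel_cross[OF ker]
  define x y z where "x = A $ e13" and "y = A $ e14" and "z = \<sigma> $ e12 * A $ e23"
  define a b where "a = \<sigma> $ e14 * \<sigma> $ e34 * \<sigma> $ e13" and "b = \<sigma> $ e14 * \<sigma> $ e34 * \<sigma> $ e23 * \<sigma> $ e12"
  have s: "(\<sigma> $ e)\<^sup>2 = 1" for e using \<sigma> by blast
  have ab: "a\<^sup>2 = 1" "b\<^sup>2 = 1" by (simp_all add: a_def b_def power_mult_distrib s)
  have sq: "(A $ e12)\<^sup>2 = (x + y)\<^sup>2" "(A $ e23)\<^sup>2 = z\<^sup>2"
    "(A $ eext2)\<^sup>2 = (x + y + z)\<^sup>2" "(A $ e34)\<^sup>2 = (a * x + b * z)\<^sup>2"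
    "(A $ eext4)\<^sup>2 = (y + (a * x + b * z))\<^sup>2"
  proof -
    show "(A $ e12)\<^sup>2 = (x + y)\<^sup>2" unfolding K x_def y_def by algebra
    show "(A $ e23)\<^sup>2 = z\<^sup>2" by (simp add: z_def power_mult_distrib s)
    show "(A $ eext2)\<^sup>2 = (x + y + z)\<^sup>2"
      unfolding K x_def y_def z_def using s[of e12] by algebra
    have "a * x + b * z = \<sigma> $ e14 * \<sigma> $ e34 * A $ e34"
      unfolding K x_def z_def a_def b_def using s[of e12] by algebra
    thus "(A $ e34)\<^sup>2 = (a * x + b * z)\<^sup>2" by (simp add: power_mult_distrib s)
    have "y + (a * x + b * z) = \<sigma> $ e14 * A $ eext4"
      unfolding \<open>a * x + b * z = _\<close> K(4) y_def using s[of e14] by algebra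
    thus "(A $ eext4)\<^sup>2 = (y + (a * x + b * z))\<^sup>2" by (simp add: power_mult_distrib s)
  qed
  have "x \<noteq> 0 \<or> y \<noteq> 0 \<or> z \<noteq> 0"
  proof (rule ccontr)
    assume "\<not> ?thesis"
    hence "\<forall>e. A $ e = 0" using sq by (auto simp: x_def y_def intro: edge.induct)
    thus False using A by (simp add: vec_eq_iff)
  qed
  moreover have "a = 1 \<or> a = -1" "b = 1 \<or> b = -1" using ab by (auto simp: power2_eq_1_iff)
  moreover have "d_hat \<bullet> hadamard_square A = 117/25 * x\<^sup>2 + 106/25 * y\<^sup>2 + 3/5 * (x + y + z)\<^sup>2
      + 109/50 * (y + (a * x + b * z))\<^sup>2 + 33/20 * (x + y)\<^sup>2 - 149/100 * z\<^sup>2 - 13/100 * (a * x + b * z)\<^sup>2"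
    by (simp add: inner_vec_def sum_edge d_hat_def hadamard_square_def sq) (simp add: x_def y_def)
  \<comment> \<open>Expanded with \<open>a\<^sup>2 = b\<^sup>2 = 1\<close>, which makes the diagonal independent of the parities.\<close>
  moreover have "\<dots> = 449/50 * x\<^sup>2 + 867/100 * y\<^sup>2 + 29/25 * z\<^sup>2
      + 2 * (9/4 + 109/50 * a) * x * y + 2 * (3/5 + 41/20 * (a * b)) * x * z + 2 * (3/5 + 109/50 * b) * y * z"
    using ab by algebra
  ultimately show ?thesis
    by (elim disjE; simp only:; intro ternary_form_positive) (simp_all add: power2_eq_square)
qed

text \<open>
  The lower bound needs a nonzero admissible amplitude for \<open>C_sing\<close> to be a minimum over a nonempty set.
  The one used here is the constant flow around the cycle \<open>v1 v3 v4\<close> with all parities equal to \<open>1\<close>.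
\<close>

lemma half_lt_C_sing_cross:
  assumes l: "edge_metric l" and \<epsilon>: "0 < \<epsilon>"
    and obs: "obs_lengths G_cross l \<omega> = (1/2) *\<^sub>R l + \<epsilon> *\<^sub>R d_hat"
  shows "1/2 < C_sing G_cross l \<omega>"
proof (rule C_sing_gt[OF l])
  fix A \<sigma> :: "real^edge"
  assume "A \<noteq> 0" "\<forall>e. (\<sigma> $ e)\<^sup>2 = 1" "parity_matrix G_cross \<sigma> *v A = 0"
  hence "0 < d_hat \<bullet> hadamard_square A" by (rule d_hat_positive_on_singular)
  thus "1/2 * (l \<bullet> hadamard_square A) < obs_lengths G_cross l \<omega> \<bullet> hadamard_square A"
    using \<epsilon> by (simp add: obs inner_add_left)
next
  define A :: "real^edge" where "A = (\<chi> e. case e of e13 \<Rightarrow> 1 | e14 \<Rightarrow> - 1 | e34 \<Rightarrow> 1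
     | e12 \<Rightarrow> 0 | e23 \<Rightarrow> 0 | eext2 \<Rightarrow> 0 | eext4 \<Rightarrow> 0)"
  have "A $ e13 \<noteq> 0" by (simp add: A_def)
  thus "A \<noteq> 0" by auto
  show "\<forall>e. ((\<chi> e. 1 :: real^edge) $ e)\<^sup>2 = 1" by simp
  have "(parity_matrix G_cross (\<chi> e. 1) *v A) $ v = 0" for v
    by (cases v) (simp_all add: parity_matrix_def matrix_vector_mult_def sum_edge G_cross_def A_def)
  thus "parity_matrix G_cross (\<chi> e. 1) *v A = 0" by (simp add: vec_eq_iff)
qed

section \<open>Secular states in terms of vertex values\<close>

text \<open>
  When no phase is a multiple of \<open>\<pi>\<close>, the vertex values determine both derivatives on every edge.
  This is the resulting triple; whether it is a secular state is then a question of the vertex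
  balances, which \<open>kirchhoff_defect\<close> records.
\<close>

definition kirchhoff_state :: "('v, 'b, 'e) mgraph \<Rightarrow> real^'e \<Rightarrow> real^'v \<Rightarrow> (real^'v) \<times> (real^'e) \<times> (real^'e)"
  where "kirchhoff_state G \<theta> \<phi> =
    (\<phi>,
     \<chi> e. case head G e of
        Inl w \<Rightarrow> (\<phi> $ w - \<phi> $ tail G e * cos (\<theta> $ e)) / sin (\<theta> $ e)
      | Inr b \<Rightarrow> - (\<phi> $ tail G e * cos (\<theta> $ e) / sin (\<theta> $ e)),
     \<chi> e. case head G e of
        Inl w \<Rightarrow> (\<phi> $ tail G e - \<phi> $ w * cos (\<theta> $ e)) / sin (\<theta> $ e)
      | Inr b \<Rightarrow> 0)"

definition kirchhoff_defect :: "('v::finite, 'b, 'e::finite) mgraph \<Rightarrow> real^'e \<Rightarrow> real^'v \<Rightarrow> 'v \<Rightarrow> real"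
  where "kirchhoff_defect G \<theta> \<phi> v =
    (\<Sum>e | tail G e = v. fst (snd (kirchhoff_state G \<theta> \<phi>)) $ e)
    + (\<Sum>e | head G e = Inl v. snd (snd (kirchhoff_state G \<theta> \<phi>)) $ e)"

lemma secular_kernel_eq:
  fixes G :: "('v::finite, 'b, 'e::finite) mgraph"
  assumes sin: "\<And>e. sin (\<theta> $ e) \<noteq> 0"
  shows "secular_kernel G \<theta> = {kirchhoff_state G \<theta> \<phi> | \<phi>. \<forall>v. kirchhoff_defect G \<theta> \<phi> v = 0}"
proof (intro equalityI subsetI)
  fix s assume s: "s \<in> secular_kernel G \<theta>"
  obtain \<phi> p p' where spp: "s = (\<phi>, p, p')" by (cases s)
  note K = s[unfolded spp secular_kernel_def mem_Collect_eq prod.case]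
  have "p $ e = fst (snd (kirchhoff_state G \<theta> \<phi>)) $ e \<and> p' $ e = snd (snd (kirchhoff_state G \<theta> \<phi>)) $ e" for e
  proof (cases "head G e")
    case (Inl w)
    hence w: "\<phi> $ w = \<phi> $ tail G e * cos (\<theta> $ e) + p $ e * sin (\<theta> $ e)"
      "- (p' $ e) = - (\<phi> $ tail G e) * sin (\<theta> $ e) + p $ e * cos (\<theta> $ e)"
      using K by blast+
    have "p $ e = (\<phi> $ w - \<phi> $ tail G e * cos (\<theta> $ e)) / sin (\<theta> $ e)"
      using w(1) sin[of e] by simp
    moreover have "p' $ e * sin (\<theta> $ e) = \<phi> $ tail G e - \<phi> $ w * cos (\<theta> $ e)"
      using w sin_cos_squared_add[of "\<theta> $ e"] by algebra
    hence "p' $ e = (\<phi> $ tail G e - \<phi> $ w * cos (\<theta> $ e)) / sin (\<theta> $ e)"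
      using sin[of e] by (simp add: field_simps)
    ultimately show ?thesis by (simp add: kirchhoff_state_def Inl)
  next
    case (Inr b)
    hence "\<phi> $ tail G e * cos (\<theta> $ e) + p $ e * sin (\<theta> $ e) = 0" "p' $ e = 0" using K by blast+
    hence "p $ e = - (\<phi> $ tail G e * cos (\<theta> $ e) / sin (\<theta> $ e))" "p' $ e = 0"
      using sin[of e] by (auto simp: field_simps)
    thus ?thesis by (simp add: kirchhoff_state_def Inr)
  qed
  hence eq: "s = kirchhoff_state G \<theta> \<phi>"
    by (auto simp: spp prod_eq_iff vec_eq_iff) (simp add: kirchhoff_state_def)
  hence "kirchhoff_defect G \<theta> \<phi> v = 0" for v
    using K by (simp add: kirchhoff_defect_def flip: eq) (simp add: spp)
  thus "s \<in> {kirchhoff_state G \<theta> \<phi> | \<phi>. \<forall>v. kirchhoff_defect G \<theta> \<phi> v = 0}" using eq by blast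
next
  fix s assume "s \<in> {kirchhoff_state G \<theta> \<phi> | \<phi>. \<forall>v. kirchhoff_defect G \<theta> \<phi> v = 0}"
  then obtain \<phi> where s: "s = kirchhoff_state G \<theta> \<phi>" and d: "\<forall>v. kirchhoff_defect G \<theta> \<phi> v = 0" by blast
  have "- ((\<phi> $ tail G e - \<phi> $ w * cos (\<theta> $ e)) / sin (\<theta> $ e)) = - (\<phi> $ tail G e) * sin (\<theta> $ e) +
    (\<phi> $ w - \<phi> $ tail G e * cos (\<theta> $ e)) / sin (\<theta> $ e) * cos (\<theta> $ e)" for e w
  proof -
    have "- (\<phi> $ tail G e) * sin (\<theta> $ e) + (\<phi> $ w - \<phi> $ tail G e * cos (\<theta> $ e)) / sin (\<theta> $ e) * cos (\<theta> $ e)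
        = (- (\<phi> $ tail G e) * (sin (\<theta> $ e))\<^sup>2 + (\<phi> $ w - \<phi> $ tail G e * cos (\<theta> $ e)) * cos (\<theta> $ e)) / sin (\<theta> $ e)"
      using sin[of e] by (simp add: field_simps power2_eq_square)
    also have "- (\<phi> $ tail G e) * (sin (\<theta> $ e))\<^sup>2 + (\<phi> $ w - \<phi> $ tail G e * cos (\<theta> $ e)) * cos (\<theta> $ e)
        = - (\<phi> $ tail G e - \<phi> $ w * cos (\<theta> $ e))"
      using sin_cos_squared_add[of "\<theta> $ e"] by algebra
    finally show ?thesis by (metis minus_divide_left)
  qed
  thus "s \<in> secular_kernel G \<theta>"
    using d sin unfolding s secular_kernel_def kirchhoff_defect_def
    by (auto simp: kirchhoff_state_def)
qed

lemma kirchhoff_state_scaleR: "kirchhoff_state G \<theta> (c *\<^sub>R \<phi>) = c *\<^sub>R kirchhoff_state G \<theta> \<phi>"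
  by (auto simp: kirchhoff_state_def vec_eq_iff algebra_simps diff_divide_distrib split: sum.split)

lemma tendsto_kirchhoff_state:
  fixes G :: "('v::finite, 'b, 'e::finite) mgraph"
  assumes "(\<theta> \<longlongrightarrow> \<theta>') F" "(\<phi> \<longlongrightarrow> \<phi>') F" "\<And>e. sin (\<theta>' $ e) \<noteq> 0"
  shows "((\<lambda>n. kirchhoff_state G (\<theta> n) (\<phi> n)) \<longlongrightarrow> kirchhoff_state G \<theta>' \<phi>') F"
  unfolding kirchhoff_state_def
proof (intro tendsto_Pair assms(2) vec_tendstoI, unfold vec_lambda_beta)
  note lim = tendsto_vec_nth[OF assms(1)] tendsto_vec_nth[OF assms(2)]
  fix e
  have trig: "((\<lambda>n. sin (\<theta> n $ e)) \<longlongrightarrow> sin (\<theta>' $ e)) F" "((\<lambda>n. cos (\<theta> n $ e)) \<longlongrightarrow> cos (\<theta>' $ e)) F"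
    using isCont_tendsto_compose[OF isCont_sin lim(1)] isCont_tendsto_compose[OF isCont_cos lim(1)]
    by this
  show "((\<lambda>n. case head G e of
        Inl w \<Rightarrow> (\<phi> n $ w - \<phi> n $ tail G e * cos (\<theta> n $ e)) / sin (\<theta> n $ e)
      | Inr b \<Rightarrow> - (\<phi> n $ tail G e * cos (\<theta> n $ e) / sin (\<theta> n $ e))) \<longlongrightarrow> (case head G e of
        Inl w \<Rightarrow> (\<phi>' $ w - \<phi>' $ tail G e * cos (\<theta>' $ e)) / sin (\<theta>' $ e)
      | Inr b \<Rightarrow> - (\<phi>' $ tail G e * cos (\<theta>' $ e) / sin (\<theta>' $ e)))) F"
    using assms(3) by (cases "head G e") (auto intro!: tendsto_intros lim trig)
  show "((\<lambda>n. case head G e of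
        Inl w \<Rightarrow> (\<phi> n $ tail G e - \<phi> n $ w * cos (\<theta> n $ e)) / sin (\<theta> n $ e)
      | Inr b \<Rightarrow> 0) \<longlongrightarrow> (case head G e of
        Inl w \<Rightarrow> (\<phi>' $ tail G e - \<phi>' $ w * cos (\<theta>' $ e)) / sin (\<theta>' $ e)
      | Inr b \<Rightarrow> 0)) F"
    using assms(3) by (cases "head G e") (auto intro!: tendsto_intros lim trig)
qed

section \<open>Elimination on the crossed graph\<close>

text \<open>
  These are the rows of the vertex matrix with entries \<open>1 / sin\<close> off the diagonal and sums of
  \<open>- cot\<close> on it, applied to the vertex values.
\<close>

lemma kirchhoff_defect_cross:
  shows "kirchhoff_defect G_cross \<theta> \<phi> v1 = \<phi> $ v2 / sin (\<theta> $ e12) + \<phi> $ v3 / sin (\<theta> $ e13)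
      + \<phi> $ v4 / sin (\<theta> $ e14) - \<phi> $ v1 * (cot (\<theta> $ e12) + cot (\<theta> $ e13) + cot (\<theta> $ e14))"
    and "kirchhoff_defect G_cross \<theta> \<phi> v2 = \<phi> $ v1 / sin (\<theta> $ e12) + \<phi> $ v3 / sin (\<theta> $ e23)
      - \<phi> $ v2 * (cot (\<theta> $ e12) + cot (\<theta> $ e23) + cot (\<theta> $ eext2))"
    and "kirchhoff_defect G_cross \<theta> \<phi> v3 = \<phi> $ v1 / sin (\<theta> $ e13) + \<phi> $ v2 / sin (\<theta> $ e23)
      + \<phi> $ v4 / sin (\<theta> $ e34) - \<phi> $ v3 * (cot (\<theta> $ e13) + cot (\<theta> $ e23) + cot (\<theta> $ e34))"
    and "kirchhoff_defect G_cross \<theta> \<phi> v4 = \<phi> $ v1 / sin (\<theta> $ e14) + \<phi> $ v3 / sin (\<theta> $ e34)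
      - \<phi> $ v4 * (cot (\<theta> $ e14) + cot (\<theta> $ e34) + cot (\<theta> $ eext4))"
proof -
  have filter_sum: "(\<Sum>e | P e. f e) = (\<Sum>e\<in>UNIV. if P e then f e else 0)"
    for P and f :: "edge \<Rightarrow> real"
    by (simp add: sum.If_cases)
  note * = kirchhoff_defect_def filter_sum sum_edge kirchhoff_state_def G_cross_def cot_def
    diff_divide_distrib algebra_simps
  show "kirchhoff_defect G_cross \<theta> \<phi> v1 = \<phi> $ v2 / sin (\<theta> $ e12) + \<phi> $ v3 / sin (\<theta> $ e13)
      + \<phi> $ v4 / sin (\<theta> $ e14) - \<phi> $ v1 * (cot (\<theta> $ e12) + cot (\<theta> $ e13) + cot (\<theta> $ e14))"
    by (simp add: *)
  show "kirchhoff_defect G_cross \<theta> \<phi> v2 = \<phi> $ v1 / sin (\<theta> $ e12) + \<phi> $ v3 / sin (\<theta> $ e23)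
      - \<phi> $ v2 * (cot (\<theta> $ e12) + cot (\<theta> $ e23) + cot (\<theta> $ eext2))"
    by (simp add: *)
  show "kirchhoff_defect G_cross \<theta> \<phi> v3 = \<phi> $ v1 / sin (\<theta> $ e13) + \<phi> $ v2 / sin (\<theta> $ e23)
      + \<phi> $ v4 / sin (\<theta> $ e34) - \<phi> $ v3 * (cot (\<theta> $ e13) + cot (\<theta> $ e23) + cot (\<theta> $ e34))"
    by (simp add: *)
  show "kirchhoff_defect G_cross \<theta> \<phi> v4 = \<phi> $ v1 / sin (\<theta> $ e14) + \<phi> $ v3 / sin (\<theta> $ e34)
      - \<phi> $ v4 * (cot (\<theta> $ e14) + cot (\<theta> $ e34) + cot (\<theta> $ eext4))"
    by (simp add: *)
qed

text \<open>
  Gaussian elimination of the vertex matrix.  Since \<open>v2\<close> and \<open>v4\<close> are not adjacent, their equations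
  express \<open>\<phi>\<^sub>2\<close> and \<open>\<phi>\<^sub>4\<close> in terms of \<open>\<phi>\<^sub>1\<close> and \<open>\<phi>\<^sub>3\<close>, and \<open>pivot3\<close> is the Schur complement that remains
  in the equation at \<open>v3\<close>.  With \<open>\<phi>\<^sub>1 = 1\<close> this determines all vertex values, and
  \<open>secular\<close> is what is left over at \<open>v1\<close>.
\<close>

definition pivot2 :: "real^edge \<Rightarrow> real" where
  "pivot2 \<theta> = cot (\<theta> $ e12) + cot (\<theta> $ e23) + cot (\<theta> $ eext2)"

definition pivot4 :: "real^edge \<Rightarrow> real" where
  "pivot4 \<theta> = cot (\<theta> $ e14) + cot (\<theta> $ e34) + cot (\<theta> $ eext4)"

definition pivot3 :: "real^edge \<Rightarrow> real" where
  "pivot3 \<theta> = cot (\<theta> $ e13) + cot (\<theta> $ e23) + cot (\<theta> $ e34)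
     - 1 / ((sin (\<theta> $ e23))\<^sup>2 * pivot2 \<theta>) - 1 / ((sin (\<theta> $ e34))\<^sup>2 * pivot4 \<theta>)"

definition value3 :: "real^edge \<Rightarrow> real" where
  "value3 \<theta> = (1 / sin (\<theta> $ e13) + 1 / (sin (\<theta> $ e12) * sin (\<theta> $ e23) * pivot2 \<theta>)
     + 1 / (sin (\<theta> $ e14) * sin (\<theta> $ e34) * pivot4 \<theta>)) / pivot3 \<theta>"

definition value2 :: "real^edge \<Rightarrow> real" where
  "value2 \<theta> = (1 / sin (\<theta> $ e12) + value3 \<theta> / sin (\<theta> $ e23)) / pivot2 \<theta>"

definition value4 :: "real^edge \<Rightarrow> real" where
  "value4 \<theta> = (1 / sin (\<theta> $ e14) + value3 \<theta> / sin (\<theta> $ e34)) / pivot4 \<theta>"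

definition vertex_values :: "real^edge \<Rightarrow> real^vtx" where
  "vertex_values \<theta> = (\<chi> v. case v of v1 \<Rightarrow> 1 | v2 \<Rightarrow> value2 \<theta> | v3 \<Rightarrow> value3 \<theta> | v4 \<Rightarrow> value4 \<theta>)"

definition secular :: "real^edge \<Rightarrow> real" where
  "secular \<theta> = value2 \<theta> / sin (\<theta> $ e12) + value3 \<theta> / sin (\<theta> $ e13) + value4 \<theta> / sin (\<theta> $ e14)
     - (cot (\<theta> $ e12) + cot (\<theta> $ e13) + cot (\<theta> $ e14))"

definition solvable :: "real^edge \<Rightarrow> bool" where
  "solvable \<theta> \<longleftrightarrow> (\<forall>e. sin (\<theta> $ e) \<noteq> 0) \<and> pivot2 \<theta> \<noteq> 0 \<and> pivot4 \<theta> \<noteq> 0 \<and> pivot3 \<theta> \<noteq> 0"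

text \<open>
  Elimination shows that a solution is fixed by its value at \<open>v1\<close>; thus the kernel at a solvable zero of
  \<open>secular\<close> is a line.  This gives both the dimension of the kernel and a solution that is
  continuous in the phases.
\<close>

lemma secular_kernel_cross:
  assumes "solvable \<theta>" "secular \<theta> = 0"
  shows "secular_kernel G_cross \<theta> = range (\<lambda>c. c *\<^sub>R kirchhoff_state G_cross \<theta> (vertex_values \<theta>))"
proof -
  have sin: "\<And>e. sin (\<theta> $ e) \<noteq> 0" and piv: "pivot2 \<theta> \<noteq> 0" "pivot4 \<theta> \<noteq> 0" "pivot3 \<theta> \<noteq> 0"
    using assms(1) by (auto simp: solvable_def)
  have "(\<forall>v. kirchhoff_defect G_cross \<theta> \<phi> v = 0) \<longleftrightarrow> \<phi> = \<phi> $ v1 *\<^sub>R vertex_values \<theta>" for \<phi>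
  proof -
    let ?a = "\<phi> $ v1" and ?b = "\<phi> $ v2" and ?c = "\<phi> $ v3" and ?d = "\<phi> $ v4"
    have all: "(\<forall>v. P v) \<longleftrightarrow> P v1 \<and> P v2 \<and> P v3 \<and> P v4" for P
      by (metis vtx.exhaust)
    have e2: "kirchhoff_defect G_cross \<theta> \<phi> v2 = 0 \<longleftrightarrow> ?b = (?a / sin (\<theta> $ e12) + ?c / sin (\<theta> $ e23)) / pivot2 \<theta>"
      using piv(1) by (auto simp: kirchhoff_defect_cross pivot2_def[symmetric] nonzero_eq_divide_eq)
    have e4: "kirchhoff_defect G_cross \<theta> \<phi> v4 = 0 \<longleftrightarrow> ?d = (?a / sin (\<theta> $ e14) + ?c / sin (\<theta> $ e34)) / pivot4 \<theta>"
      using piv(2) by (auto simp: kirchhoff_defect_cross pivot4_def[symmetric] nonzero_eq_divide_eq)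
    \<comment> \<open>Substituting the equations at \<open>v2\<close> and \<open>v4\<close> turns the coefficient of \<open>\<phi>\<^sub>3\<close> into \<open>- pivot3\<close>.\<close>
    have e3: "kirchhoff_defect G_cross \<theta> \<phi> v3 = 0 \<longleftrightarrow> ?c = ?a * value3 \<theta>"
      if "?b = (?a / sin (\<theta> $ e12) + ?c / sin (\<theta> $ e23)) / pivot2 \<theta>"
        "?d = (?a / sin (\<theta> $ e14) + ?c / sin (\<theta> $ e34)) / pivot4 \<theta>"
    proof -
      have "value3 \<theta> * pivot3 \<theta> = 1 / sin (\<theta> $ e13) + 1 / (sin (\<theta> $ e12) * sin (\<theta> $ e23) * pivot2 \<theta>)
          + 1 / (sin (\<theta> $ e14) * sin (\<theta> $ e34) * pivot4 \<theta>)"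
        using piv(3) by (simp add: value3_def)
      hence "kirchhoff_defect G_cross \<theta> \<phi> v3 = ?a * (value3 \<theta> * pivot3 \<theta>) - ?c * pivot3 \<theta>"
        unfolding kirchhoff_defect_cross that
        by (simp add: pivot3_def algebra_simps power2_eq_square add_divide_distrib)
      also have "\<dots> = (?a * value3 \<theta> - ?c) * pivot3 \<theta>" by algebra
      finally show ?thesis using piv(3) by auto
    qed
    have split: "?a * value2 \<theta> = (?a / sin (\<theta> $ e12) + ?a * value3 \<theta> / sin (\<theta> $ e23)) / pivot2 \<theta>"
      "?a * value4 \<theta> = (?a / sin (\<theta> $ e14) + ?a * value3 \<theta> / sin (\<theta> $ e34)) / pivot4 \<theta>"
      by (simp_all add: value2_def value4_def algebra_simps)
    have e1: "kirchhoff_defect G_cross \<theta> \<phi> v1 = ?a * secular \<theta>"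
      if "?b = ?a * value2 \<theta>" "?c = ?a * value3 \<theta>" "?d = ?a * value4 \<theta>"
      unfolding kirchhoff_defect_cross that secular_def by (simp add: algebra_simps)
    have "\<phi> = ?a *\<^sub>R vertex_values \<theta> \<longleftrightarrow> ?b = ?a * value2 \<theta> \<and> ?c = ?a * value3 \<theta> \<and> ?d = ?a * value4 \<theta>"
      unfolding vec_eq_iff all by (simp add: vertex_values_def)
    thus ?thesis
      unfolding all using e1 e2 e3 e4 split assms(2) by (metis mult_zero_right)
  qed
  hence "secular_kernel G_cross \<theta> = {kirchhoff_state G_cross \<theta> \<phi> | \<phi>. \<phi> = \<phi> $ v1 *\<^sub>R vertex_values \<theta>}"
    by (simp add: secular_kernel_eq[OF sin])
  also have "\<dots> = range (\<lambda>c. kirchhoff_state G_cross \<theta> (c *\<^sub>R vertex_values \<theta>))"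
  proof -
    have "vertex_values \<theta> $ v1 = 1" by (simp add: vertex_values_def)
    hence "(\<exists>c. \<phi> = c *\<^sub>R vertex_values \<theta>) \<longleftrightarrow> \<phi> = \<phi> $ v1 *\<^sub>R vertex_values \<theta>" for \<phi> by auto
    hence "{kirchhoff_state G_cross \<theta> \<phi> | \<phi>. \<phi> = \<phi> $ v1 *\<^sub>R vertex_values \<theta>}
        = {kirchhoff_state G_cross \<theta> \<phi> | \<phi>. \<exists>c. \<phi> = c *\<^sub>R vertex_values \<theta>}" by (simp only:)
    thus ?thesis by blast
  qed
  finally show ?thesis by (simp add: kirchhoff_state_scaleR)
qed

lemma isCont_cot_nth:
  assumes "\<And>e. sin (\<theta> $ e) \<noteq> 0"
  shows "isCont (\<lambda>x. cot (x $ e)) (\<theta> :: real^'e)"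
  by (rule isCont_o2[where g = cot, OF _ isCont_cot]) (auto intro!: continuous_intros assms)

lemma isCont_pivots:
  assumes "\<And>e. sin (\<theta> $ e) \<noteq> 0"
  shows "isCont pivot2 \<theta>" "isCont pivot4 \<theta>"
  unfolding pivot2_def[abs_def] pivot4_def[abs_def] using assms
  by (auto intro!: continuous_intros isCont_cot_nth)

lemma isCont_pivot3:
  assumes "\<And>e. sin (\<theta> $ e) \<noteq> 0" "pivot2 \<theta> \<noteq> 0" "pivot4 \<theta> \<noteq> 0"
  shows "isCont pivot3 \<theta>"
  unfolding pivot3_def[abs_def] using assms
  by (auto intro!: continuous_intros isCont_cot_nth isCont_pivots)

lemma isCont_values:
  assumes "solvable \<theta>"
  shows "isCont value2 \<theta>" "isCont value3 \<theta>" "isCont value4 \<theta>" "isCont secular \<theta>"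
proof -
  have sin: "\<And>e. sin (\<theta> $ e) \<noteq> 0" and piv: "pivot2 \<theta> \<noteq> 0" "pivot4 \<theta> \<noteq> 0" "pivot3 \<theta> \<noteq> 0"
    using assms by (auto simp: solvable_def)
  note pc = isCont_pivots[OF sin] isCont_pivot3[OF sin piv(1,2)]
  show c3: "isCont value3 \<theta>"
    unfolding value3_def[abs_def] using sin piv by (auto intro!: continuous_intros pc)
  show c2: "isCont value2 \<theta>"
    unfolding value2_def[abs_def] using sin piv by (auto intro!: continuous_intros pc c3)
  show c4: "isCont value4 \<theta>"
    unfolding value4_def[abs_def] using sin piv by (auto intro!: continuous_intros pc c3)
  show "isCont secular \<theta>"
    unfolding secular_def[abs_def] using sin piv by (auto intro!: continuous_intros isCont_cot_nth c2 c3 c4)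
qed

lemma eventually_solvable:
  assumes "solvable \<theta>"
  shows "eventually solvable (nhds \<theta>)"
proof -
  have sin: "\<And>e. sin (\<theta> $ e) \<noteq> 0" and piv: "pivot2 \<theta> \<noteq> 0" "pivot4 \<theta> \<noteq> 0" "pivot3 \<theta> \<noteq> 0"
    using assms by (auto simp: solvable_def)
  have ne: "eventually (\<lambda>x. f x \<noteq> 0) (nhds \<theta>)" if "isCont f \<theta>" "f \<theta> \<noteq> 0" for f :: "real^edge \<Rightarrow> real"
    using tendsto_imp_eventually_ne that unfolding isCont_def tendsto_at_iff_tendsto_nhds by blast
  have "isCont (\<lambda>x. sin (x $ e)) \<theta>" for e by (intro continuous_intros)
  hence "eventually (\<lambda>x. \<forall>e. sin (x $ e) \<noteq> 0) (nhds \<theta>)"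
    by (intro eventually_all_finite ne sin)
  thus ?thesis
    unfolding solvable_def
    by (intro eventually_conj ne piv isCont_pivots isCont_pivot3 sin)
qed

section \<open>An explicit regular state with negative gain\<close>

text \<open>
  The radicands are \<open>25 - 1/25\<close> and \<open>16 - 1/25\<close>: the explicit state has the value \<open>1/5\<close> at \<open>v2\<close> and
  \<open>v4\<close>, and these are the sizes of its derivatives there on edges of energies \<open>25\<close> and \<open>16\<close>.
\<close>

definition root2 :: real where "root2 = sqrt (624 / 25)"
definition root4 :: real where "root4 = sqrt (399 / 25)"

lemma roots:
  "root2\<^sup>2 = 624 / 25" "root4\<^sup>2 = 399 / 25" "499 / 100 < root2" "root2 < 5" "399 / 100 < root4" "root4 < 4"
proof -
  show "root2\<^sup>2 = 624 / 25" "root4\<^sup>2 = 399 / 25" by (simp_all add: root2_def root4_def)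
  show "499 / 100 < root2" "399 / 100 < root4"
    unfolding root2_def root4_def by (rule real_less_rsqrt; simp add: power2_eq_square)+
  show "root2 < 5" "root4 < 4"
    unfolding root2_def root4_def by (rule real_less_lsqrt; simp add: power2_eq_square)+
qed

text \<open>
  These phases are obtained from a state.  Across an internal edge the vector \<open>(\<phi>, p)\<close> is rotated
  by the phase, so any two values and derivatives at its ends with equal energy
  \<open>\<phi>\<^sup>2 + p\<^sup>2\<close> determine a phase, and at a terminal edge \<open>cot \<theta> = - p / \<phi>\<close>.  A state thus amounts to a
  solution of the balances \<open>\<Sum> p = 0\<close> with matching energies.  The one used has \<open>\<phi> = (1, 1/5, 0, 1/5)\<close> and
  energies \<open>1, 2, 2, 25, 16\<close> on \<open>e13, e14, e12, e23, e34\<close>; at \<open>v3\<close> the balance is \<open>-1 + 5 - 4 = 0\<close>.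
  Energy is concentrated on \<open>e23\<close>, where \<open>d_hat\<close> is most negative.  Vanishing values at \<open>v2\<close>, \<open>v3\<close> and
  \<open>v4\<close> would make the phases of the edges between them singular; the small values \<open>1/5\<close> avoid this.
\<close>

definition base_phase :: "real^edge \<Rightarrow> bool" where
  "base_phase l \<longleftrightarrow>
     cos (l $ e12) = - 3/5 \<and> sin (l $ e12) = - 4/5 \<and>
     cos (l $ e13) = 0 \<and> sin (l $ e13) = - 1 \<and>
     cos (l $ e14) = - 3/5 \<and> sin (l $ e14) = 4/5 \<and>
     cos (l $ e23) = - root2 / 5 \<and> sin (l $ e23) = 1/25 \<and>
     cos (l $ e34) = - root4 / 4 \<and> sin (l $ e34) = - 1/20 \<and>
     cot (l $ eext2) = 5 * root2 - 7 \<and> sin (l $ eext2) \<noteq> 0 \<and>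
     cot (l $ eext4) = 7 - 5 * root4 \<and> sin (l $ eext4) \<noteq> 0"

lemma base_phase_exists: "\<exists>l. edge_metric l \<and> base_phase l"
proof -
  have circle: "\<exists>t>0. cos t = x \<and> sin t = y" if xy: "x\<^sup>2 + y\<^sup>2 = 1" "y \<noteq> 0" for x y :: real
  proof -
    obtain t where "0 \<le> t" "t < 2 * pi" "x = cos t" "y = sin t"
      using sincos_total_2pi[OF xy(1)] by blast
    moreover have "t \<noteq> 0" using \<open>y = sin t\<close> xy(2) by auto
    ultimately show ?thesis by (intro exI[of _ t]) auto
  qed
  have line: "\<exists>t>0. cot t = x \<and> sin t \<noteq> 0" for x :: real
  proof (intro exI conjI)
    \<comment> \<open>The witness is the arc cotangent with values in \<open>(0, \<pi>)\<close>.\<close>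
    show "0 < pi / 2 - arctan x" using arctan_ubound[of x] by simp
    have c: "0 < cos (arctan x)" by (rule cos_gt_zero_pi) (use arctan_lbound[of x] arctan_ubound[of x] in auto)
    thus "sin (pi / 2 - arctan x) \<noteq> 0" by (simp add: sin_diff)
    have "cot (pi / 2 - arctan x) = tan (arctan x)"
      by (simp add: cot_def tan_def sin_diff cos_diff)
    thus "cot (pi / 2 - arctan x) = x" by (simp add: tan_arctan)
  qed
  obtain t12 t13 t14 t23 t34 :: real where
    "t12 > 0 \<and> cos t12 = - 3/5 \<and> sin t12 = - 4/5" "t13 > 0 \<and> cos t13 = 0 \<and> sin t13 = - 1"
    "t14 > 0 \<and> cos t14 = - 3/5 \<and> sin t14 = 4/5" "t23 > 0 \<and> cos t23 = - root2 / 5 \<and> sin t23 = 1/25"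
    "t34 > 0 \<and> cos t34 = - root4 / 4 \<and> sin t34 = - 1/20"
    using circle[of "- 3/5" "- 4/5"] circle[of 0 "- 1"] circle[of "- 3/5" "4/5"]
      circle[of "- root2 / 5" "1/25"] circle[of "- root4 / 4" "- 1/20"]
    by (auto simp: power_divide roots)
  moreover obtain u2 u4 where "u2 > 0 \<and> cot u2 = 5 * root2 - 7 \<and> sin u2 \<noteq> 0"
    "u4 > 0 \<and> cot u4 = 7 - 5 * root4 \<and> sin u4 \<noteq> 0" using line by blast
  ultimately show ?thesis
    by (intro exI[of _ "\<chi> e. case e of e13 \<Rightarrow> t13 | e14 \<Rightarrow> t14 | eext2 \<Rightarrow> u2 | eext4 \<Rightarrow> u4
          | e12 \<Rightarrow> t12 | e23 \<Rightarrow> t23 | e34 \<Rightarrow> t34"])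
      (simp add: base_phase_def edge_metric_def all_edges)
qed

context
  fixes l :: "real^edge"
  assumes base: "base_phase l"
begin

lemma base_trig:
  "cos (l $ e12) = - 3/5" "sin (l $ e12) = - 4/5" "cos (l $ e13) = 0" "sin (l $ e13) = - 1"
  "cos (l $ e14) = - 3/5" "sin (l $ e14) = 4/5" "cos (l $ e23) = - root2 / 5" "sin (l $ e23) = 1/25"
  "cos (l $ e34) = - root4 / 4" "sin (l $ e34) = - 1/20"
  "cot (l $ eext2) = 5 * root2 - 7" "sin (l $ eext2) \<noteq> 0"
  "cot (l $ eext4) = 7 - 5 * root4" "sin (l $ eext4) \<noteq> 0"
  using base by (simp_all add: base_phase_def)

lemma base_cot:
  "cot (l $ e12) = 3/4" "cot (l $ e13) = 0" "cot (l $ e14) = - 3/4"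
  "cot (l $ e23) = - 5 * root2" "cot (l $ e34) = 5 * root4"
  by (simp_all add: cot_def base_trig)

lemma base_sin: "sin (l $ e) \<noteq> 0"
  by (cases e) (simp_all add: base_trig)

lemma base_pivots:
  "pivot2 l = - 25/4" "pivot4 l = 25/4" "pivot3 l = 36 - 5 * root2 + 5 * root4"
proof -
  show p: "pivot2 l = - 25/4" "pivot4 l = 25/4"
    by (simp_all add: pivot2_def pivot4_def base_cot base_trig)
  show "pivot3 l = 36 - 5 * root2 + 5 * root4"
    by (simp add: pivot3_def p base_cot base_trig power2_eq_square)
qed

lemma base_solvable: "solvable l"
  using roots by (auto simp: solvable_def base_sin base_pivots)

lemma base_values: "value3 l = 0" "value2 l = 1/5" "value4 l = 1/5" "secular l = 0"
proof -
  show v3: "value3 l = 0" by (simp add: value3_def base_pivots base_trig)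
  show v: "value2 l = 1/5" "value4 l = 1/5"
    by (simp_all add: value2_def value4_def v3 base_pivots base_trig)
  show "secular l = 0" by (simp add: secular_def v v3 base_cot base_trig)
qed

definition base_state :: "(real^vtx) \<times> (real^edge) \<times> (real^edge)" where
  "base_state = kirchhoff_state G_cross l (vertex_values l)"

lemma base_momenta:
  "fst (snd base_state) $ e = (case e of e13 \<Rightarrow> 0 | e14 \<Rightarrow> 1 | eext2 \<Rightarrow> 7/5 - root2
    | eext4 \<Rightarrow> root4 - 7/5 | e12 \<Rightarrow> - 1 | e23 \<Rightarrow> root2 | e34 \<Rightarrow> - 4)"
proof -
  have "cos (l $ eext2) = (5 * root2 - 7) * sin (l $ eext2)"
    "cos (l $ eext4) = (7 - 5 * root4) * sin (l $ eext4)"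
    using base_trig(11-14) by (simp_all add: cot_def field_simps)
  thus ?thesis
    by (cases e) (simp_all add: base_state_def kirchhoff_state_def G_cross_def
      vertex_values_def base_values base_trig field_simps)
qed

lemma base_energy:
  "edge_energy G_cross base_state = (\<chi> e. case e of
      e13 \<Rightarrow> 1 | e14 \<Rightarrow> 2 | eext2 \<Rightarrow> 1/25 + (7/5 - root2)\<^sup>2 | eext4 \<Rightarrow> 1/25 + (root4 - 7/5)\<^sup>2
    | e12 \<Rightarrow> 2 | e23 \<Rightarrow> 25 | e34 \<Rightarrow> 16)"
proof -
  have "fst base_state = vertex_values l" by (simp add: base_state_def kirchhoff_state_def)
  hence "edge_energy G_cross base_state $ e = (vertex_values l $ tail G_cross e)\<^sup>2
      + (fst (snd base_state) $ e)\<^sup>2" for e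
    by (simp add: edge_energy_def case_prod_beta)
  thus ?thesis
    by (auto simp: vec_eq_iff all_edges base_momenta vertex_values_def base_values G_cross_def
      power_divide roots)
qed

lemma base_energy_d_hat: "d_hat \<bullet> edge_energy G_cross base_state < 0"
proof -
  have sq: "(7/5 - root2)\<^sup>2 = 673/25 - 14/5 * root2" "(root4 - 7/5)\<^sup>2 = 448/25 - 14/5 * root4"
    using roots(1,2) by (simp_all add: power2_diff power_divide)
  have "d_hat \<bullet> edge_energy G_cross base_state
      = - 2287/100 + 3/5 * (674/25 - 14/5 * root2) + 109/50 * (449/25 - 14/5 * root4)"
    by (simp add: inner_vec_def sum_edge d_hat_def base_energy sq)
  also have "\<dots> = 81147/2500 - 42/25 * root2 - 763/125 * root4" by (simp add: field_simps)
  also have "\<dots> < 0" using roots(3,5) by linarith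
  finally show ?thesis .
qed

lemma base_energy_pos:
  assumes "edge_metric l"
  shows "0 < l \<bullet> edge_energy G_cross base_state"
proof -
  have "0 < edge_energy G_cross base_state $ e" for e
    by (cases e) (auto simp: base_energy intro: add_pos_nonneg)
  thus ?thesis
    using assms by (auto simp: inner_vec_def edge_metric_def intro!: sum_pos)
qed

lemma base_kernel: "secular_kernel G_cross l = range (\<lambda>c. c *\<^sub>R base_state)"
  unfolding base_state_def by (rule secular_kernel_cross[OF base_solvable base_values(4)])

lemma base_state_nonzero: "base_state \<noteq> 0"
proof -
  have "fst base_state $ v1 = 1"
    by (simp add: base_state_def kirchhoff_state_def vertex_values_def)
  thus ?thesis by auto
qed

lemma dim_base_kernel: "dim (secular_kernel G_cross l) = 1"
proof -
  have "secular_kernel G_cross l = span {base_state}"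
    by (simp add: base_kernel span_singleton)
  moreover have "dim {base_state} = 1"
    using base_state_nonzero by (intro dim_unique[of "{base_state}"]) (auto simp: span_base)
  ultimately show ?thesis by (simp add: dim_span)
qed

lemma base_nonsingular: "nonsingular_phase l"
  unfolding nonsingular_phase_def
proof
  fix e
  have "l $ e \<noteq> of_int n * pi" for n
    using base_sin[of e] by (metis sin_zero_iff_int2)
  thus "l $ e \<notin> pi_multiples" by (auto simp: pi_multiples_def)
qed

lemma base_regular: "regular_state G_cross l base_state"
  unfolding regular_state_def
proof (intro conjI allI impI)
  have "1 *\<^sub>R base_state \<in> secular_kernel G_cross l" unfolding base_kernel by (rule rangeI)
  thus "base_state \<in> secular_kernel G_cross l" by simp
  show "base_state \<noteq> 0" by (rule base_state_nonzero)
  show "l $ e \<notin> pi_multiples" for e using base_nonsingular by (simp add: nonsingular_phase_def)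
qed

text \<open>
  The derivatives of the eliminated vertex values cancel.  Adding to \<open>secular\<close> the equations at
  \<open>v2\<close> and \<open>v4\<close>, which hold identically, with the weights \<open>\<phi>\<^sub>2 = \<phi>\<^sub>4 = 1/5\<close> of the base state yields a
  function \<open>H\<close> in which, by symmetry of the vertex matrix, each of these derivatives is multiplied by
  one of the equations satisfied by the base state.  What remains is the quadratic form of the
  differentiated vertex matrix on the base state, that is \<open>l\<bullet>r\<close>.
\<close>

lemma secular_crosses:
  assumes l: "edge_metric l"
  obtains D where "((\<lambda>t. secular (l + t *\<^sub>R l)) has_real_derivative D) (at 0)" "0 < D"
proof -
  define \<theta> where "\<theta> t = l + t *\<^sub>R l" for t
  have \<theta>0: "\<theta> 0 = l" by (simp add: \<theta>_def)
  have nth: "((\<lambda>t. \<theta> t $ e) has_real_derivative l $ e) (at 0)" for e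
    unfolding \<theta>_def by (auto intro!: derivative_eq_intros)
  have dcot: "((\<lambda>t. cot (\<theta> t $ e)) has_real_derivative - (l $ e) / (sin (l $ e))\<^sup>2) (at 0)" for e
    using DERIV_chain2[OF DERIV_cot nth, of e] base_sin[of e] by (simp add: \<theta>0 divide_inverse mult.commute)
  have dinv: "((\<lambda>t. 1 / sin (\<theta> t $ e)) has_real_derivative
      - (cos (l $ e) * l $ e) / (sin (l $ e))\<^sup>2) (at 0)" for e
    using base_sin[of e] nth[of e] \<theta>0
    by (auto intro!: derivative_eq_intros simp: power2_eq_square)
  have sin0: "sin (\<theta> 0 $ e) \<noteq> 0" for e by (simp add: \<theta>0 base_sin)
  have piv0: "pivot2 (\<theta> 0) \<noteq> 0" "pivot4 (\<theta> 0) \<noteq> 0" "pivot3 (\<theta> 0) \<noteq> 0"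
    using base_solvable by (auto simp: \<theta>0 solvable_def)
  define P2 where "P2 = - (l $ e12) / (sin (l $ e12))\<^sup>2 - l $ e23 / (sin (l $ e23))\<^sup>2 - l $ eext2 / (sin (l $ eext2))\<^sup>2"
  define P4 where "P4 = - (l $ e14) / (sin (l $ e14))\<^sup>2 - l $ e34 / (sin (l $ e34))\<^sup>2 - l $ eext4 / (sin (l $ eext4))\<^sup>2"
  have d2: "((\<lambda>t. pivot2 (\<theta> t)) has_real_derivative P2) (at 0)"
    unfolding pivot2_def P2_def by (auto intro!: derivative_eq_intros dcot)
  have d4: "((\<lambda>t. pivot4 (\<theta> t)) has_real_derivative P4) (at 0)"
    unfolding pivot4_def P4_def by (auto intro!: derivative_eq_intros dcot)
  have dsin: "(\<lambda>t. sin (\<theta> t $ e)) field_differentiable at 0" for e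
    unfolding field_differentiable_def using DERIV_chain2[OF DERIV_sin nth, of e] by blast
  have fd: "(\<lambda>t. cot (\<theta> t $ e)) field_differentiable at 0"
    "(\<lambda>t. pivot2 (\<theta> t)) field_differentiable at 0" "(\<lambda>t. pivot4 (\<theta> t)) field_differentiable at 0" for e
    unfolding field_differentiable_def using dcot d2 d4 by blast+
  have fd3: "(\<lambda>t. pivot3 (\<theta> t)) field_differentiable at 0"
    unfolding pivot3_def using sin0 piv0
    by (intro derivative_intros fd dsin) auto
  have fv3: "(\<lambda>t. value3 (\<theta> t)) field_differentiable at 0"
    unfolding value3_def using sin0 piv0
    by (intro derivative_intros fd fd3 dsin) auto
  have fv: "(\<lambda>t. value2 (\<theta> t)) field_differentiable at 0" "(\<lambda>t. value4 (\<theta> t)) field_differentiable at 0"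
    unfolding value2_def value4_def using sin0 piv0
    by (intro derivative_intros fd fv3 dsin; simp)+
  obtain V2 V3 V4 where V:
    "((\<lambda>t. value2 (\<theta> t)) has_real_derivative V2) (at 0)"
    "((\<lambda>t. value3 (\<theta> t)) has_real_derivative V3) (at 0)"
    "((\<lambda>t. value4 (\<theta> t)) has_real_derivative V4) (at 0)"
    using fv fv3 unfolding field_differentiable_def by blast
  define H where "H t = value2 (\<theta> t) * (1 / sin (\<theta> t $ e12)) + value3 (\<theta> t) * (1 / sin (\<theta> t $ e13))
      + value4 (\<theta> t) * (1 / sin (\<theta> t $ e14))
      - (cot (\<theta> t $ e12) + cot (\<theta> t $ e13) + cot (\<theta> t $ e14))
      + 1/5 * (1 / sin (\<theta> t $ e12) + value3 (\<theta> t) * (1 / sin (\<theta> t $ e23)) - pivot2 (\<theta> t) * value2 (\<theta> t))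
      + 1/5 * (1 / sin (\<theta> t $ e14) + value3 (\<theta> t) * (1 / sin (\<theta> t $ e34)) - pivot4 (\<theta> t) * value4 (\<theta> t))" for t
  \<comment> \<open>This is \<open>l\<bullet>r\<close> for the base energies \<open>r\<close>; on a terminal edge \<open>r = \<phi>\<^sup>2 / sin\<^sup>2\<close>.\<close>
  define D where "D = 2 * l $ e12 + l $ e13 + 2 * l $ e14 + 25 * l $ e23 + 16 * l $ e34
      + l $ eext2 / (25 * (sin (l $ eext2))\<^sup>2) + l $ eext4 / (25 * (sin (l $ eext4))\<^sup>2)"
  have "(H has_real_derivative D) (at 0)"
    unfolding H_def
    by (rule derivative_eq_intros dcot dinv d2 d4 V refl | simp)+
       (simp add: D_def P2_def P4_def \<theta>0 base_values base_pivots base_trig power2_eq_square field_simps)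
  moreover have ev: "eventually (\<lambda>t. H t = secular (\<theta> t)) (nhds 0)"
  proof -
    have "isCont \<theta> 0" unfolding \<theta>_def by (intro continuous_intros)
    hence "filterlim \<theta> (nhds (\<theta> 0)) (nhds 0)"
      by (simp only: isCont_def tendsto_at_iff_tendsto_nhds)
    hence "filterlim \<theta> (nhds l) (nhds 0)" by (simp only: \<theta>0)
    hence "eventually (\<lambda>t. solvable (\<theta> t)) (nhds 0)"
      using eventually_solvable[OF base_solvable] by (rule eventually_compose_filterlim[rotated])
    thus ?thesis
      by eventually_elim (auto simp: H_def secular_def value2_def value4_def solvable_def)
  qed
  ultimately have "((\<lambda>t. secular (\<theta> t)) has_real_derivative D) (at 0)"
    using DERIV_cong_ev[OF refl ev refl, of D] by blast
  moreover have "0 < D"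
    using l base_sin unfolding D_def edge_metric_def
    by (intro add_pos_pos mult_pos_pos divide_pos_pos) auto
  ultimately show ?thesis using that unfolding \<theta>_def by blast
qed

text \<open>
  The states at the recurring zeros of \<open>secular\<close> converge to the base state because the eliminated
  vertex values are continuous near the base phase.
\<close>

lemma base_recurrence:
  assumes l: "edge_metric l"
  obtains k s \<theta> where "filterlim k at_top sequentially"
    "\<And>n. s n \<in> secular_kernel G_cross (\<theta> n)" "\<And>n. phases_match (k n) l (\<theta> n)"
    "s \<longlonglongrightarrow> base_state"
proof -
  obtain D where D: "((\<lambda>t. secular (l + t *\<^sub>R l)) has_real_derivative D) (at 0)" "0 < D"
    using secular_crosses[OF l] .
  have ev: "eventually solvable (nhds l)" by (rule eventually_solvable[OF base_solvable])
  hence cont: "eventually (isCont secular) (nhds l)"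
    by eventually_elim (rule isCont_values)
  obtain k \<theta> where k: "filterlim k at_top sequentially" and \<theta>: "\<theta> \<longlonglongrightarrow> l"
    and zero: "\<And>n. secular (\<theta> n) = 0" and ph: "\<And>n. phases_match (k n) l (\<theta> n)"
    by (rule recurrent_zeros[where F = secular and l = l and D = D, OF cont base_values(4) D]) blast
  have "eventually (\<lambda>n. solvable (\<theta> n)) sequentially"
    using ev \<theta> by (rule eventually_compose_filterlim)
  then obtain N where N: "\<And>n. N \<le> n \<Longrightarrow> solvable (\<theta> n)" unfolding eventually_sequentially by blast
  define s where "s n = kirchhoff_state G_cross (\<theta> (n + N)) (vertex_values (\<theta> (n + N)))" for n
  have \<theta>': "(\<lambda>n. \<theta> (n + N)) \<longlonglongrightarrow> l" using \<theta> by (rule LIMSEQ_ignore_initial_segment)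
  have "(\<lambda>n. vertex_values (\<theta> (n + N))) \<longlonglongrightarrow> vertex_values l"
  proof (rule vec_tendstoI)
    fix v
    show "(\<lambda>n. vertex_values (\<theta> (n + N)) $ v) \<longlonglongrightarrow> vertex_values l $ v"
      by (cases v) (auto simp: vertex_values_def
        intro!: isCont_tendsto_compose[OF _ \<theta>'] isCont_values base_solvable)
  qed
  hence lim: "s \<longlonglongrightarrow> base_state"
    unfolding s_def base_state_def by (intro tendsto_kirchhoff_state \<theta>' base_sin)
  have "s n \<in> secular_kernel G_cross (\<theta> (n + N))" for n
  proof -
    have "1 *\<^sub>R s n \<in> secular_kernel G_cross (\<theta> (n + N))"
      unfolding s_def secular_kernel_cross[OF N[of "n + N", simplified] zero] by (rule rangeI)
    thus ?thesis by simp
  qed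
  thus ?thesis
    using that[of "\<lambda>n. k (n + N)" s "\<lambda>n. \<theta> (n + N)"] lim ph
      filterlim_compose[OF k filterlim_add_const_nat_at_top] by blast
qed

end

section \<open>The strict gap\<close>

theorem theorem1p1:
  shows
    "(\<exists>(G :: (vtx, ext, edge) mgraph) l \<omega>.
        admissible_graph G \<and> cycle_rank G = 2 \<and> CARD(edge) = 7 \<and> CARD(ext) = 2 \<and>
        edge_metric l \<and> measurable_subset G l \<omega> \<and>
        C_infinity G l \<omega> < C_sing G l \<omega>) \<and>
     admissible_graph G_cross \<and> cycle_rank G_cross = 2 \<and>
     (\<exists>(l :: real^edge) (\<omega> :: (vtx, ext, edge) gpoint set) (\<epsilon> :: real).
        edge_metric l \<and> measurable_subset G_cross l \<omega> \<and>
        \<epsilon> > 0 \<and>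
        obs_lengths G_cross l \<omega> = (1/2) *\<^sub>R l + \<epsilon> *\<^sub>R d_hat \<and>
        (\<forall>e. 0 < obs_lengths G_cross l \<omega> $ e \<and> obs_lengths G_cross l \<omega> $ e < l $ e) \<and>
        C_infinity G_cross l \<omega> < 1/2 \<and> 1/2 < C_sing G_cross l \<omega> \<and>
        (\<exists>(k :: nat \<Rightarrow> real) (u :: nat \<Rightarrow> (vtx, ext, edge) gpoint \<Rightarrow> complex) \<theta> s r.
           filterlim k at_top sequentially \<and>
           (\<forall>n. k n > 0 \<and> laplace_eq G_cross l ((k n)\<^sup>2) (u n) \<and> L2_norm G_cross l (u n) = 1) \<and>
           regular_state G_cross \<theta> s \<and> nonsingular_phase \<theta> \<and>
           dim (secular_kernel G_cross \<theta>) = 1 \<and>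
           r = edge_energy G_cross s \<and> d_hat \<bullet> r < 0 \<and>
           (\<lambda>n. intensity G_cross l (k n) (u n)) \<longlonglongrightarrow> (1 / (l \<bullet> r)) *\<^sub>R r \<and>
           (\<lambda>n. L2_mass_on G_cross l \<omega> (u n))
             \<longlonglongrightarrow> (obs_lengths G_cross l \<omega> \<bullet> r) / (l \<bullet> r) \<and>
           (obs_lengths G_cross l \<omega> \<bullet> r) / (l \<bullet> r) < 1/2))"
proof -
  \<comment> \<open>The phase vector of the explicit state serves as the metric.\<close>
  obtain l where l: "edge_metric l" and base: "base_phase l" using base_phase_exists by blast
  obtain \<epsilon> where \<epsilon>: "0 < \<epsilon>" and between: "\<And>e. 0 < ((1/2) *\<^sub>R l + \<epsilon> *\<^sub>R d_hat) $ e"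
    "\<And>e. ((1/2) *\<^sub>R l + \<epsilon> *\<^sub>R d_hat) $ e < l $ e"
    using admissible_perturbation[OF l] by blast
  define a where "a = (1/2) *\<^sub>R l + \<epsilon> *\<^sub>R d_hat"
  have a_le: "0 \<le> a $ e" "a $ e \<le> l $ e" for e
    using between[of e] unfolding a_def by (simp_all only: less_imp_le)
  define \<omega> :: "(vtx, ext, edge) gpoint set" where "\<omega> = initial_segments a"
  have tr: "edge_trace G_cross l \<omega> e = {0<..a $ e}" and meas: "measurable_subset G_cross l \<omega>"
    and obs: "obs_lengths G_cross l \<omega> = a" for e
    unfolding \<omega>_def by (rule initial_segments[OF between[folded a_def]])+
  define s where "s = base_state l"
  define r where "r = edge_energy G_cross s"
  have dr: "d_hat \<bullet> r < 0" unfolding r_def s_def by (rule base_energy_d_hat[OF base])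
  have lr: "0 < l \<bullet> r" unfolding r_def s_def by (rule base_energy_pos[OF base l])
  obtain k0 s0 \<theta>0 where k0: "filterlim k0 at_top sequentially"
    and s0: "\<And>n. s0 n \<in> secular_kernel G_cross (\<theta>0 n)" "\<And>n. phases_match (k0 n) l (\<theta>0 n)"
    and lim: "s0 \<longlonglongrightarrow> s"
    unfolding s_def using base_recurrence[OF base l] by blast
  obtain k u where k: "filterlim k at_top sequentially" "\<And>n. k n > 0"
    and u: "\<And>n. laplace_eq G_cross l ((k n)\<^sup>2) (u n)" "\<And>n. L2_norm G_cross l (u n) = 1"
    and int: "(\<lambda>n. intensity G_cross l (k n) (u n)) \<longlonglongrightarrow> (1 / (l \<bullet> r)) *\<^sub>R r"
    and mass: "(\<lambda>n. L2_mass_on G_cross l \<omega> (u n)) \<longlonglongrightarrow> (a \<bullet> r) / (l \<bullet> r)"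
    by (rule eigensequence[where \<omega> = \<omega> and a = a, OF l k0 s0 lim r_def lr a_le tr]) blast
  \<comment> \<open>The gain over one half is \<open>\<epsilon> d_hat\<bullet>r\<close>, which is negative.\<close>
  have "a \<bullet> r = 1/2 * (l \<bullet> r) + \<epsilon> * (d_hat \<bullet> r)" by (simp add: a_def inner_add_left)
  also have "\<dots> < 1/2 * (l \<bullet> r)" using \<epsilon> dr by (simp add: mult_pos_neg)
  finally have half: "(a \<bullet> r) / (l \<bullet> r) < 1/2" using lr by (simp add: field_simps)
  have C: "C_infinity G_cross l \<omega> < 1/2"
    using C_infinity_le_limit[OF k(1) u mass] half by linarith
  have Csing: "1/2 < C_sing G_cross l \<omega>"
    by (rule half_lt_C_sing_cross[OF l \<epsilon>]) (simp only: obs a_def)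
  have "\<exists>k u \<theta> s r. filterlim k at_top sequentially \<and>
           (\<forall>n. k n > 0 \<and> laplace_eq G_cross l ((k n)\<^sup>2) (u n) \<and> L2_norm G_cross l (u n) = 1) \<and>
           regular_state G_cross \<theta> s \<and> nonsingular_phase \<theta> \<and>
           dim (secular_kernel G_cross \<theta>) = 1 \<and>
           r = edge_energy G_cross s \<and> d_hat \<bullet> r < 0 \<and>
           (\<lambda>n. intensity G_cross l (k n) (u n)) \<longlonglongrightarrow> (1 / (l \<bullet> r)) *\<^sub>R r \<and>
           (\<lambda>n. L2_mass_on G_cross l \<omega> (u n))
             \<longlonglongrightarrow> (obs_lengths G_cross l \<omega> \<bullet> r) / (l \<bullet> r) \<and>
           (obs_lengths G_cross l \<omega> \<bullet> r) / (l \<bullet> r) < 1/2"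
    unfolding obs
    by (intro exI[of _ k] exI[of _ u] exI[of _ l] exI[of _ s] exI[of _ r] conjI allI
        k u int mass half dr r_def base_nonsingular[OF base] dim_base_kernel[OF base])
      (simp add: s_def base_regular[OF base])
  moreover have "C_infinity G_cross l \<omega> < C_sing G_cross l \<omega>" using C Csing by linarith
  moreover have "\<forall>e. 0 < obs_lengths G_cross l \<omega> $ e \<and> obs_lengths G_cross l \<omega> $ e < l $ e"
    using between by (simp only: obs a_def) blast
  moreover have "obs_lengths G_cross l \<omega> = (1/2) *\<^sub>R l + \<epsilon> *\<^sub>R d_hat" by (simp only: obs a_def)
  ultimately show ?thesis
    using l meas \<epsilon> C Csing admissible_cross cycle_rank_cross cards by blast
qed

end
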